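(* Let $\Phi$ be the unstructured model, i.e. the set of all MDPs $\psi$ on $\mathcal{S},\mathcal{A}$ with $p_\psi(\cdot|x,a)\in\mathcal{P}(\mathcal{S})$ and $q_\psi(\cdot|x,a)\in\mathcal{P}([0,1])$ for all $(x,a)$, and let $\phi\in\Phi$ be ergodic. Let $$\mathcal{F}_{\mathrm{un}}(\phi)=\Big\{\eta\in\bar{\mathbb{R}}_+^{S\times A}:\ \eta(x,a)\Big(\frac{\delta^*(x,a;\phi)}{H+1}\Big)^2\ge 2\ \ \forall (x,a)\text{ with }a\notin\mathcal{O}(x;\phi)\Big\}.$$ Then $\mathcal{F}_{\mathrm{un}}(\phi)\subset\mathcal{F}_\Phi(\phi)$, and consequently $$K_\Phi(\phi):=\inf_{\eta\in\mathcal{F}_\Phi(\phi)}\sum_{(x,a)}\eta(x,a)\,\delta^*(x,a;\phi)\ \le\ 2\,\frac{(H+1)^2}{\delta_{\min}}\,SA.$$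
   Context: MDPs. $\mathcal{S}$ and $\mathcal{A}$ are finite sets of sizes $S$ and $A$. An MDP $\phi=(p_\phi,q_\phi)$ consists of transition probabilities $p_\phi(y|x,a)$ and reward distributions $q_\phi(\cdot|x,a)$ on $[0,1]$, with mean $r_\phi(x,a)$, each absolutely continuous w.r.t. a fixed measure $\lambda$ on $[0,1]$ (density also denoted $q_\phi$). $\mathcal{P}(\mathcal{S})$ is the set of distributions on $\mathcal{S}$, and $\mathcal{P}([0,1])$ the set of distributions on $[0,1]$ absolutely continuous w.r.t. $\lambda$. $X_t,A_t,R_t$ denote the state, action and reward at step $t$. Gain, bias, gaps. $\Pi_D$ is the set of stationary deterministic policies $f:\mathcal{S}\to\mathcal{A}$. $\phi$ is ergodic if under every $f\in\Pi_D$ the Markov chain $(X_t)$ is irreducible. The gain is $g_\phi^f(x)=\lim_{T\to\infty}\frac1T \mathbb{E}_x^f[\sum_{t=1}^T R_t]$, $g_\phi^*$ is the maximal gain (over all policies; a constant for ergodic $\phi$), and $\Pi^*(\phi)$ is the set of $f\in\Pi_D$ whose gain is maximal from every state. The bias of $f$ is $h_\phi^f(x)=\text{C-}\lim_{T\to\infty}\mathbb{E}_x^f[\sum_{t=1}^{T}(R_t-g_\phi^f(X_t))]$ (Cesàro limit), and $h_\phi^*$ is the bias function of an optimal stationary policy (unique up to an additive constant for ergodic $\phi$); its span is $H=\max_{x,y}(h_\phi^*(x)-h_\phi^*(y))$. For $h:\mathcal{S}\to\mathbb{R}$, $(\mathbf{B}_\phi^a h)(x)=r_\phi(x,a)+\sum_y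 p_\phi(y|x,a)h(y)$ and $(\mathbf{B}_\phi^* h)(x)=\max_{a\in\mathcal{A}}(\mathbf{B}_\phi^a h)(x)$. $\mathcal{O}(x;\phi)=\{a:(\mathbf{B}_\phi^* h_\phi^* )(x)=(\mathbf{B}_\phi^a h_\phi^* )(x)\}$, $\delta^*(x,a;\phi)=(\mathbf{B}_\phi^*h_\phi^* )(x)-(\mathbf{B}_\phi^a h_\phi^* )(x)$, and $\delta_{\min}=\min\{\delta^*(x,a;\phi):\delta^*(x,a;\phi)>0\}$ (the set being nonempty whenever $\delta_{\min}$ is used). Confusing MDPs. $\phi\ll\psi$ means that the kernels of $\phi$ are absolutely continuous w.r.t. those of $\psi$. For $\phi\ll\psi$, $$\mathrm{KL}_{\phi\mid\psi}(x,a)=\sum_{y}p_\phi(y|x,a)\log\frac{p_\phi(y|x,a)}{p_\psi(y|x,a)}+\int_0^1 q_\phi(r|x,a)\log\frac{q_\phi(r|x,a)}{q_\psi(r|x,a)}\lambda(dr).$$ $\Delta_\Phi(\phi)$ is the set of $\psi\in\Phi$ with $\phi\ll\psi$ such that (i) $\mathrm{KL}_{\phi\mid\psi}(x,a)=0$ for all $x$ and all $a\in\mathcal{O}(x;\phi)$, and (ii) $\Pi^*(\phi)\cap\Pi^*(\psi)=\emptyset$. Then $$\mathcal{F}_\Phi(\phi)=\Big\{\eta\in\bar{\mathbb{R}}_+^{S\times A}:\ \sum_{(x,a)}\eta(x,a)\,\mathrm{KL}_{\phi\mid\psi}(x,a)\ge 1\ \ \forall\psi\in\Delta_\Phi(\phi)\Big\},$$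 where $\bar{\mathbb{R}}_+=\mathbb{R}_+\cup\{\infty\}$, with $\infty\cdot 0=0$. *)

theory Defs
  imports "HOL-Probability.Probability"
begin

section \<open>MDPs with finite state and action spaces\<close>

record ('s, 'a) mdp =
  trans :: "'s \<Rightarrow> 'a \<Rightarrow> 's pmf"
  rew :: "'s \<Rightarrow> 'a \<Rightarrow> real measure"

abbreviation unit_borel :: "real measure" where
  "unit_borel \<equiv> restrict_space borel {0..1}"

text \<open>
  The laws on [0,1] that have a density with respect to \<open>lam\<close>. For sigma-finite \<open>lam\<close> this is
  absolute continuity (Radon-Nikodym, see \<open>reward_laws_sigma_finite\<close>); for an arbitrary measure
  absolute continuity alone would not provide the density used in the Kullback-Leibler integral.
\<close>
definition reward_laws :: "real measure \<Rightarrow> real measure set" where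
  "reward_laws lam = {Q. prob_space Q \<and> (\<exists>f \<in> borel_measurable lam. Q = density lam f)}"

lemma reward_laws_sigma_finite:
  assumes "sigma_finite_measure lam"
  shows "reward_laws lam = {Q. prob_space Q \<and> sets Q = sets lam \<and> absolutely_continuous lam Q}"
proof -
  interpret sigma_finite_measure lam by fact
  show ?thesis
    unfolding reward_laws_def
    using Radon_Nikodym absolutely_continuousI_density by (auto simp: eq_commute)
qed

definition unstructured :: "real measure \<Rightarrow> ('s, 'a) mdp set" where
  "unstructured lam = {\<phi>. \<forall>x a. rew \<phi> x a \<in> reward_laws lam}"

definition mean_reward :: "('s, 'a) mdp \<Rightarrow> 's \<Rightarrow> 'a \<Rightarrow> real" where
  "mean_reward \<phi> x a = (\<integral>r. r \<partial>rew \<phi> x a)"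

section \<open>Policies and the induced process\<close>

text \<open>
  A trajectory is a sequence of triples (state, action, reward). Time starts at 0, so the
  paper's step \<open>t \<ge> 1\<close> is index \<open>t - 1\<close>.
\<close>
abbreviation step_space :: "('s \<times> 'a \<times> real) measure" where
  "step_space \<equiv> count_space UNIV \<Otimes>\<^sub>M (count_space UNIV \<Otimes>\<^sub>M unit_borel)"

text \<open>
  \<open>\<pi> t \<omega> y\<close> is the distribution of the action at time \<open>t\<close>, given the triples \<open>\<omega> 0, \<dots>, \<omega> (t - 1)\<close>
  and the current state \<open>y\<close>.
\<close>
type_synonym ('s, 'a) policy = "nat \<Rightarrow> (nat \<Rightarrow> 's \<times> 'a \<times> real) \<Rightarrow> 's \<Rightarrow> 'a pmf"

definition policies :: "('s, 'a) policy set" where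
  "policies = {\<pi>. \<forall>t y a.
     (\<lambda>\<omega>. pmf (\<pi> t \<omega> y) a) \<in> borel_measurable (PiM {0..<t} (\<lambda>_. step_space))}"

definition stationary :: "('s \<Rightarrow> 'a) \<Rightarrow> ('s, 'a) policy" where
  "stationary f = (\<lambda>t \<omega> y. return_pmf (f y))"

definition step_kernel ::
  "('s, 'a) mdp \<Rightarrow> ('s, 'a) policy \<Rightarrow> 's \<Rightarrow> nat \<Rightarrow> (nat \<Rightarrow> 's \<times> 'a \<times> real) \<Rightarrow> ('s \<times> 'a \<times> real) measure"
where
  "step_kernel \<phi> \<pi> x t \<omega> =
     measure_pmf
       (if t = 0 then return_pmf x
        else case \<omega> (t - 1) of (y, a, r) \<Rightarrow> trans \<phi> y a) \<bind> (\<lambda>y.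
     measure_pmf (\<pi> t \<omega> y) \<bind> (\<lambda>a.
     distr (rew \<phi> y a) step_space (\<lambda>r. (y, a, r))))"

text \<open>The law of the trajectory started in \<open>x\<close>, given by the Ionescu-Tulcea extension theorem.\<close>
definition traj ::
  "('s, 'a) mdp \<Rightarrow> ('s, 'a) policy \<Rightarrow> 's \<Rightarrow> (nat \<Rightarrow> 's \<times> 'a \<times> real) measure" where
  "traj \<phi> \<pi> x =
     projective_family.lim UNIV
       (Ionescu_Tulcea.CI (step_kernel \<phi> \<pi> x) (\<lambda>_. step_space)) (\<lambda>_. step_space)"

lemma Ionescu_Tulcea_step_kernel:
  fixes \<phi> :: "('s::finite, 'a::finite) mdp"
  assumes l: "sets lam = sets unit_borel" and \<phi>: "\<phi> \<in> unstructured lam" and \<pi>: "\<pi> \<in> policies"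
  shows "Ionescu_Tulcea (step_kernel \<phi> \<pi> x) (\<lambda>_. step_space)"
proof -
  have sr: "sets (rew \<phi> y a) = sets unit_borel" and pr: "prob_space (rew \<phi> y a)" for y a
    using \<phi> l by (auto simp: unstructured_def reward_laws_def) (metis sets_density)+
  let ?D = "\<lambda>y a. distr (rew \<phi> y a) step_space (\<lambda>r. (y, a, r))"
  have m: "(\<lambda>r. (y, a, r)) \<in> measurable (rew \<phi> y a) step_space" for y a
    unfolding measurable_cong_sets[OF sr refl] by measurable
  have D: "?D y a \<in> space (prob_algebra step_space)" for y a
    using prob_space.prob_space_distr[OF pr m] by (auto simp: space_prob_algebra)
  have pm: "measure_pmf p \<in> space (prob_algebra (count_space UNIV))" for p :: "'c pmf"
    by (auto simp: space_prob_algebra measure_pmf.prob_space_axioms)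
  have pmm: "(\<lambda>\<omega>. measure_pmf (p \<omega>)) \<in> measurable N (prob_algebra (count_space UNIV))"
    if "\<And>a. (\<lambda>\<omega>. pmf (p \<omega>) a) \<in> borel_measurable N" for N and p :: "'d \<Rightarrow> ('c::finite) pmf"
  proof (rule measurable_prob_algebraI)
    show "(\<lambda>\<omega>. measure_pmf (p \<omega>)) \<in> N \<rightarrow>\<^sub>M subprob_algebra (count_space UNIV)"
      using that
      by (intro measurable_subprob_algebra)
        (auto simp: emeasure_measure_pmf_finite measure_pmf.subprob_space_axioms)
  qed (simp add: measure_pmf.prob_space_axioms)
  have K: "step_kernel \<phi> \<pi> x t \<in> measurable (PiM {0..<t} (\<lambda>_. step_space)) (prob_algebra step_space)" for t
    unfolding step_kernel_def
  proof (rule measurable_bind_prob_space2[where N="count_space UNIV"])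
    show "(\<lambda>\<omega>. measure_pmf (if t = 0 then return_pmf x else case \<omega> (t - 1) of (y, a, r) \<Rightarrow> trans \<phi> y a))
      \<in> Pi\<^sub>M {0..<t} (\<lambda>_. step_space) \<rightarrow>\<^sub>M prob_algebra (count_space UNIV)"
    proof (cases "t = 0")
      case False
      have c: "(\<lambda>\<omega>. \<omega> (t - 1)) \<in> measurable (PiM {0..<t} (\<lambda>_. step_space)) (step_space :: ('s \<times> 'a \<times> real) measure)"
        using False by (intro measurable_component_singleton) auto
      have c2: "(\<lambda>\<omega>. (fst (\<omega> (t - 1)), fst (snd (\<omega> (t - 1))))) \<in> measurable (PiM {0..<t} (\<lambda>_. step_space)) (count_space (UNIV :: ('s\<times>'a) set))"
        using c by (simp add: pair_measure_countable[symmetric] countable_finite) 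
      have "(\<lambda>\<omega>. measure_pmf (trans \<phi> (fst (\<omega> (t - 1))) (fst (snd (\<omega> (t - 1))))))
        \<in> Pi\<^sub>M {0..<t} (\<lambda>_. step_space) \<rightarrow>\<^sub>M prob_algebra (count_space UNIV)"
        using measurable_compose[OF c2, of "\<lambda>z. measure_pmf (trans \<phi> (fst z) (snd z))" "prob_algebra (count_space UNIV)"] pm
        by auto
      then show ?thesis using False by (simp add: case_prod_beta')
    next case True show ?thesis unfolding True if_True eqTrueI[OF refl] using measurable_const[OF pm[of "return_pmf x"]] by simp
 qed
  next
    have "(\<lambda>\<omega>. measure_pmf (\<pi> t \<omega> y) \<bind> ?D y) \<in> measurable (PiM {0..<t} (\<lambda>_. step_space)) (prob_algebra step_space)" for y
    proof (rule measurable_bind_prob_space[where N="count_space UNIV"])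
      show "(\<lambda>\<omega>. measure_pmf (\<pi> t \<omega> y)) \<in> Pi\<^sub>M {0..<t} (\<lambda>_. step_space) \<rightarrow>\<^sub>M prob_algebra (count_space UNIV)"
        using \<pi> by (intro pmm) (auto simp: policies_def)
    qed (use D in auto)
    note E = this
    have "(\<lambda>z. (\<lambda>y z. measure_pmf (\<pi> t (fst z) y) \<bind> ?D y) (snd z) z) \<in> Pi\<^sub>M {0..<t} (\<lambda>_. step_space) \<Otimes>\<^sub>M count_space UNIV \<rightarrow>\<^sub>M prob_algebra step_space"
      by (rule measurable_compose_countable'[where I=UNIV])
        (use measurable_compose[OF measurable_fst E] in \<open>auto simp: countable_finite\<close>)
    then show "(\<lambda>(\<omega>, y). measure_pmf (\<pi> t \<omega> y) \<bind> ?D y) \<in> Pi\<^sub>M {0..<t} (\<lambda>_. step_space) \<Otimes>\<^sub>M count_space UNIV \<rightarrow>\<^sub>M prob_algebra step_space"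
      by (simp add: case_prod_beta')
  qed
  show ?thesis
  apply (rule Ionescu_Tulcea.intro)
  subgoal using K by (rule measurable_prob_algebraD)
  subgoal premises p for i w using measurable_space[OF K p] by (auto simp: space_prob_algebra)
  done
qed

definition state_at :: "(nat \<Rightarrow> 's \<times> 'a \<times> real) \<Rightarrow> nat \<Rightarrow> 's" where
  "state_at \<omega> t = fst (\<omega> t)"

definition reward_at :: "(nat \<Rightarrow> 's \<times> 'a \<times> real) \<Rightarrow> nat \<Rightarrow> real" where
  "reward_at \<omega> t = snd (snd (\<omega> t))"

definition ergodic :: "('s, 'a) mdp \<Rightarrow> bool" where
  "ergodic \<phi> \<longleftrightarrow> (\<forall>f x y. \<exists>t.
     measure (traj \<phi> (stationary f) x) {\<omega> \<in> space (traj \<phi> (stationary f) x). state_at \<omega> t = y} > 0)"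

section \<open>Gain, bias and gaps\<close>

definition avg_reward :: "('s, 'a) mdp \<Rightarrow> ('s, 'a) policy \<Rightarrow> 's \<Rightarrow> nat \<Rightarrow> real" where
  "avg_reward \<phi> \<pi> x T = (\<integral>\<omega>. (\<Sum>t<T. reward_at \<omega> t) \<partial>traj \<phi> \<pi> x) / real T"

definition gain :: "('s, 'a) mdp \<Rightarrow> ('s \<Rightarrow> 'a) \<Rightarrow> 's \<Rightarrow> real" where
  "gain \<phi> f x = lim (avg_reward \<phi> (stationary f) x)"

text \<open>For a general policy the limit of the averages need not exist; its gain is the lower limit.\<close>
definition opt_gain :: "('s, 'a) mdp \<Rightarrow> 's \<Rightarrow> ereal" where
  "opt_gain \<phi> x = (SUP \<pi> \<in> policies. liminf (\<lambda>T. ereal (avg_reward \<phi> \<pi> x T)))"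

definition opt_policies :: "('s, 'a) mdp \<Rightarrow> ('s \<Rightarrow> 'a) set" where
  "opt_policies \<phi> = {f. \<forall>x. ereal (gain \<phi> f x) = opt_gain \<phi> x}"

definition cesaro_lim :: "(nat \<Rightarrow> real) \<Rightarrow> real" where
  "cesaro_lim u = lim (\<lambda>N. (\<Sum>T=1..N. u T) / real N)"

definition bias :: "('s, 'a) mdp \<Rightarrow> ('s \<Rightarrow> 'a) \<Rightarrow> 's \<Rightarrow> real" where
  "bias \<phi> f x = cesaro_lim (\<lambda>T.
     \<integral>\<omega>. (\<Sum>t<T. reward_at \<omega> t - gain \<phi> f (state_at \<omega> t)) \<partial>traj \<phi> (stationary f) x)"

text \<open>
  For ergodic \<open>\<phi>\<close> the choice only affects an additive constant, which cancels in all the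
  notions below.
\<close>
definition opt_bias :: "('s, 'a) mdp \<Rightarrow> 's \<Rightarrow> real" where
  "opt_bias \<phi> = bias \<phi> (SOME f. f \<in> opt_policies \<phi>)"

definition bias_span :: "('s::finite, 'a) mdp \<Rightarrow> real" where
  "bias_span \<phi> = Max (range (\<lambda>(x, y). opt_bias \<phi> x - opt_bias \<phi> y))"

definition bellman :: "('s::finite, 'a) mdp \<Rightarrow> 'a \<Rightarrow> ('s \<Rightarrow> real) \<Rightarrow> 's \<Rightarrow> real" where
  "bellman \<phi> a h x = mean_reward \<phi> x a + (\<Sum>y\<in>UNIV. pmf (trans \<phi> x a) y * h y)"

definition bellman_opt :: "('s::finite, 'a::finite) mdp \<Rightarrow> ('s \<Rightarrow> real) \<Rightarrow> 's \<Rightarrow> real" where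
  "bellman_opt \<phi> h x = Max (range (\<lambda>a. bellman \<phi> a h x))"

definition opt_actions :: "('s::finite, 'a::finite) mdp \<Rightarrow> 's \<Rightarrow> 'a set" where
  "opt_actions \<phi> x = {a. bellman_opt \<phi> (opt_bias \<phi>) x = bellman \<phi> a (opt_bias \<phi>) x}"

definition gap :: "('s::finite, 'a::finite) mdp \<Rightarrow> 's \<Rightarrow> 'a \<Rightarrow> real" where
  "gap \<phi> x a = bellman_opt \<phi> (opt_bias \<phi>) x - bellman \<phi> a (opt_bias \<phi>) x"

definition positive_gaps :: "('s::finite, 'a::finite) mdp \<Rightarrow> real set" where
  "positive_gaps \<phi> = {gap \<phi> x a | x a. gap \<phi> x a > 0}"

definition min_gap :: "('s::finite, 'a::finite) mdp \<Rightarrow> real" where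
  "min_gap \<phi> = Min (positive_gaps \<phi>)"

section \<open>Confusing MDPs\<close>

text \<open>\<open>mdp_ac \<phi> \<psi>\<close> is \<open>\<phi> \<ll> \<psi>\<close>; note that \<^const>\<open>absolutely_continuous\<close> takes the dominating measure first.\<close>
definition mdp_ac :: "('s, 'a) mdp \<Rightarrow> ('s, 'a) mdp \<Rightarrow> bool" where
  "mdp_ac \<phi> \<psi> \<longleftrightarrow> (\<forall>x a.
     absolutely_continuous (measure_pmf (trans \<psi> x a)) (measure_pmf (trans \<phi> x a)) \<and>
     absolutely_continuous (rew \<psi> x a) (rew \<phi> x a))"

text \<open>
  Integral with values in the extended reals: the Bochner integral would be 0 when the
  Kullback-Leibler divergence is infinite.
\<close>
definition ext_integral :: "'b measure \<Rightarrow> ('b \<Rightarrow> real) \<Rightarrow> ereal" where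
  "ext_integral M f = enn2ereal (\<integral>\<^sup>+x. ennreal (f x) \<partial>M) - enn2ereal (\<integral>\<^sup>+x. ennreal (- f x) \<partial>M)"

definition rew_density :: "real measure \<Rightarrow> ('s, 'a) mdp \<Rightarrow> 's \<Rightarrow> 'a \<Rightarrow> real \<Rightarrow> real" where
  "rew_density lam \<phi> x a r = enn2real (RN_deriv lam (rew \<phi> x a) r)"

text \<open>
  Only meaningful if \<open>mdp_ac \<phi> \<psi>\<close>; the convention \<open>0 log 0 = 0\<close> holds as \<open>ln\<close> is a total function.
\<close>
definition KL :: "real measure \<Rightarrow> ('s::finite, 'a) mdp \<Rightarrow> ('s, 'a) mdp \<Rightarrow> 's \<Rightarrow> 'a \<Rightarrow> ereal" where
  "KL lam \<phi> \<psi> x a =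
     ereal (\<Sum>y\<in>UNIV. pmf (trans \<phi> x a) y * ln (pmf (trans \<phi> x a) y / pmf (trans \<psi> x a) y)) +
     ext_integral lam (\<lambda>r. rew_density lam \<phi> x a r *
       ln (rew_density lam \<phi> x a r / rew_density lam \<psi> x a r))"

definition confusing ::
  "real measure \<Rightarrow> ('s::finite, 'a::finite) mdp set \<Rightarrow> ('s, 'a) mdp \<Rightarrow> ('s, 'a) mdp set" where
  "confusing lam \<Phi> \<phi> = {\<psi> \<in> \<Phi>. mdp_ac \<phi> \<psi> \<and>
     (\<forall>x. \<forall>a \<in> opt_actions \<phi> x. KL lam \<phi> \<psi> x a = 0) \<and>
     opt_policies \<phi> \<inter> opt_policies \<psi> = {}}"

text \<open>In \<^typ>\<open>ereal\<close>, \<open>\<infinity> * 0 = 0\<close>.\<close>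
definition feasible ::
  "real measure \<Rightarrow> ('s::finite, 'a::finite) mdp set \<Rightarrow> ('s, 'a) mdp \<Rightarrow> ('s \<times> 'a \<Rightarrow> ereal) set" where
  "feasible lam \<Phi> \<phi> = {\<eta>. (\<forall>xa. 0 \<le> \<eta> xa) \<and>
     (\<forall>\<psi> \<in> confusing lam \<Phi> \<phi>. (\<Sum>(x, a)\<in>UNIV. \<eta> (x, a) * KL lam \<phi> \<psi> x a) \<ge> 1)}"

definition feasible_un :: "('s::finite, 'a::finite) mdp \<Rightarrow> ('s \<times> 'a \<Rightarrow> ereal) set" where
  "feasible_un \<phi> = {\<eta>. (\<forall>xa. 0 \<le> \<eta> xa) \<and>
     (\<forall>x a. a \<notin> opt_actions \<phi> x \<longrightarrow> \<eta> (x, a) * ereal ((gap \<phi> x a / (bias_span \<phi> + 1))\<^sup>2) \<ge> 2)}"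

definition regret_const ::
  "real measure \<Rightarrow> ('s::finite, 'a::finite) mdp set \<Rightarrow> ('s, 'a) mdp \<Rightarrow> ereal" where
  "regret_const lam \<Phi> \<phi> =
     (INF \<eta> \<in> feasible lam \<Phi> \<phi>. \<Sum>(x, a)\<in>UNIV. \<eta> (x, a) * ereal (gap \<phi> x a))"

end

theory Submission
  imports Defs
begin

text \<open>
  Let \<open>h\<close> be the optimal bias and \<open>g\<close> the optimal gain of \<open>\<phi>\<close>, and let \<open>\<psi>\<close> be confusing. An optimal policy
  of \<open>\<phi>\<close> plays optimal actions, on which \<open>\<psi>\<close> agrees with \<open>\<phi>\<close>, so it has gain \<open>g\<close> in \<open>\<psi>\<close> as well. If no
  Bellman backup of \<open>h\<close> under \<open>\<psi>\<close> exceeded \<open>g + h\<close>, no policy could have a larger gain in \<open>\<psi>\<close>, and this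
  policy would be optimal for both. So some suboptimal pair \<open>(x, a)\<close> has
  \<open>bellman \<psi> a h x - bellman \<phi> a h x > gap \<phi> x a\<close>. The left-hand side is at most \<open>H + 1\<close> times a total
  variation distance, and a Pinsker inequality gives \<open>KL \<ge> (gap / (H + 1))\<^sup>2\<close> at \<open>(x, a)\<close>. The constant is
  worse than in Pinsker's inequality by a factor 2, but the factor 2 in the definition of
  \<open>feasible_un\<close> leaves room for that.
\<close>

section \<open>The Poisson equation of a finite irreducible chain\<close>

text \<open>The transition matrix acting on functions, that is, conditional expectation after one
  step; \<open>chain_op K ^^ t\<close> then gives \<open>t\<close>-step expectations, and on
  indicators \<open>t\<close>-step probabilities.\<close>

definition chain_op :: "('s::finite \<Rightarrow> 's pmf) \<Rightarrow> ('s \<Rightarrow> real) \<Rightarrow> 's \<Rightarrow> real" where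
  "chain_op K u x = (\<Sum>y\<in>UNIV. pmf (K x) y * u y)"

definition irreducible_chain :: "('s::finite \<Rightarrow> 's pmf) \<Rightarrow> bool" where
  "irreducible_chain K \<longleftrightarrow> (\<forall>x y. \<exists>t. (chain_op K ^^ t) (indicator {y}) x > 0)"

lemma sum_pmf_UNIV [simp]: "(\<Sum>y\<in>UNIV. pmf p (y::'s::finite)) = 1"
  by (rule sum_pmf_eq_1) auto

lemma chain_op_add: "chain_op K (\<lambda>y. u y + v y) = (\<lambda>x. chain_op K u x + chain_op K v x)"
  by (auto simp: chain_op_def fun_eq_iff distrib_left sum.distrib)

lemma chain_op_cmult: "chain_op K (\<lambda>y. c * u y) = (\<lambda>x. c * chain_op K u x)"
  by (auto simp: chain_op_def fun_eq_iff sum_distrib_left mult_ac)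

lemma chain_op_const: "chain_op K (\<lambda>y. c) = (\<lambda>x. c)"
  by (auto simp: chain_op_def fun_eq_iff sum_distrib_right[symmetric])

lemma chain_op_diff: "chain_op K (\<lambda>y. u y - v y) = (\<lambda>x. chain_op K u x - chain_op K v x)"
  by (auto simp: chain_op_def fun_eq_iff right_diff_distrib sum_subtractf)

lemma chain_op_mono: "(\<And>y. u y \<le> v y) \<Longrightarrow> chain_op K u x \<le> chain_op K v x"
  by (auto simp: chain_op_def intro!: sum_mono mult_left_mono)

lemma chain_op_pow_add:
  "(chain_op K ^^ t) (\<lambda>y. u y + v y) = (\<lambda>x. (chain_op K ^^ t) u x + (chain_op K ^^ t) v x)"
  by (induction t) (auto simp: chain_op_add)

lemma chain_op_pow_diff:
  "(chain_op K ^^ t) (\<lambda>y. u y - v y) = (\<lambda>x. (chain_op K ^^ t) u x - (chain_op K ^^ t) v x)"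
  by (induction t) (auto simp: chain_op_diff)

lemma chain_op_pow_cmult:
  "(chain_op K ^^ t) (\<lambda>y. c * u y) = (\<lambda>x. c * (chain_op K ^^ t) u x)"
  by (induction t) (auto simp: chain_op_cmult)

lemma chain_op_pow_const: "(chain_op K ^^ t) (\<lambda>y. c) = (\<lambda>x. c)"
  by (induction t) (auto simp: chain_op_const)

lemma chain_op_pow_mono:
  "(\<And>y. u y \<le> v y) \<Longrightarrow> (chain_op K ^^ t) u x \<le> (chain_op K ^^ t) v x"
  by (induction t arbitrary: x) (auto intro: chain_op_mono)

lemma chain_op_pow_superharmonic:
  assumes "\<And>x. chain_op K d x \<le> d x"
  shows "(chain_op K ^^ t) d x \<le> d x"
proof (induction t arbitrary: x)
  case (Suc t)
  have "chain_op K ((chain_op K ^^ t) d) x \<le> chain_op K d x"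
    by (rule chain_op_mono) (rule Suc)
  with assms[of x] show ?case by simp
qed simp

text \<open>Minimum principle: start the chain at a minimiser \<open>x0\<close> of \<open>d\<close>.
  If some reachable \<open>y\<close> had a larger value, the expectation of \<open>d\<close> at the
  time of reaching \<open>y\<close> would exceed \<open>d x0\<close>, against
  superharmonicity.\<close>

lemma superharmonic_constant:
  assumes irr: "irreducible_chain K" and d: "\<And>x. chain_op K d x \<le> d x"
  shows "d x = d y"
proof -
  obtain x0 where x0: "\<And>y. d x0 \<le> d y"
  proof -
    have "Min (range d) \<in> range d" by (rule Min_in) auto
    then obtain x0 where "d x0 = Min (range d)" by (metis imageE)
    then show ?thesis using that[of x0] by simp
  qed
  have "d y \<le> d x0" for y
  proof -
    obtain t where t: "(chain_op K ^^ t) (indicator {y}) x0 > 0"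
      using irr unfolding irreducible_chain_def by blast
    let ?e = "d y - d x0"
    \<comment> \<open>\<open>d\<close> dominates the function that is \<open>d y\<close> at
      \<open>y\<close> and the minimum \<open>d x0\<close> elsewhere.\<close>
    have "d x0 + ?e * (chain_op K ^^ t) (indicator {y}) x0
      = (chain_op K ^^ t) (\<lambda>z. d x0 + ?e * indicator {y} z) x0"
      by (simp add: chain_op_pow_add chain_op_pow_cmult chain_op_pow_const)
    also have "\<dots> \<le> (chain_op K ^^ t) d x0"
      using x0 by (intro chain_op_pow_mono) (auto split: split_indicator)
    also have "\<dots> \<le> d x0" by (rule chain_op_pow_superharmonic[OF d])
    finally have "?e * (chain_op K ^^ t) (indicator {y}) x0 \<le> 0" by simp
    with t show ?thesis by (simp add: mult_le_0_iff)
  qed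
  with x0 have "d y = d x0" for y by (meson antisym)
  then show ?thesis by metis
qed

text \<open>
  \<open>h \<mapsto> h - K h + h(x0)\<close> is injective by the maximum principle, hence surjective.
\<close>
lemma poisson_equation_solvable:
  fixes K :: "'s::finite \<Rightarrow> 's pmf"
  assumes irr: "irreducible_chain K"
  obtains g h where "\<And>x. r x + chain_op K h x = g + h x"
proof -
  fix x0 :: 's
  define L :: "real ^ 's \<Rightarrow> real ^ 's" where
    "L h = (\<chi> x. h $ x - chain_op K (($) h) x + h $ x0)" for h
  have nth: "(($) (b1 + b2)) = (\<lambda>i. b1 $ i + b2 $ i)" "(($) (c *\<^sub>R b1)) = (\<lambda>i. c * b1 $ i)" for b1 b2 :: "real ^ 's" and c
    by auto
  have "linear L"
    by (rule linearI)
      (auto simp: L_def nth vec_eq_iff chain_op_add chain_op_cmult algebra_simps)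
  moreover have "inj L"
    unfolding linear_injective_0[OF \<open>linear L\<close>]
  proof (intro allI impI)
    fix v assume "L v = 0"
    then have v: "v $ x - chain_op K (($) v) x + v $ x0 = 0" for x
      by (simp add: L_def vec_eq_iff)
    have const: "v $ x = v $ x0" for x
    \<comment> \<open>Since \<open>v - K v\<close> is the constant \<open>- v $ x0\<close>, one of
      \<open>v\<close> and \<open>- v\<close> is superharmonic, depending on the sign of that
      constant.\<close>
    proof (cases "v $ x0 \<le> 0")
      case True
      have "chain_op K (($) v) y \<le> v $ y" for y using v[of y] True by linarith
      then show ?thesis by (rule superharmonic_constant[OF irr])
    next
      case False
      have "chain_op K (\<lambda>z. (-1) * v $ z) y \<le> (-1) * v $ y" for y
        using v[of y] False unfolding chain_op_cmult by linarith
      from superharmonic_constant[OF irr this] show ?thesis by simp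
    qed
    then have "($) v = (\<lambda>_. v $ x0)" by auto
    then have "chain_op K (($) v) x0 = v $ x0" by (metis chain_op_const)
    with v[of x0] have "v $ x0 = 0" by simp
    with const show "v = 0" by (simp add: vec_eq_iff)
  qed
  ultimately have "surj L" by (rule linear_injective_imp_surjective) simp
  then obtain h where h: "L h = (\<chi> x. r x)" by (metis surjD)
  show ?thesis
  proof (rule that)
    fix x
    have "(L h) $ x = r x" by (simp add: h)
    \<comment> \<open>The extra term \<open>h $ x0\<close> in \<open>L\<close> supplies the constant
      of the Poisson equation.\<close>
    then show "r x + chain_op K (($) h) x = h $ x0 + h $ x" by (simp add: L_def)
  qed
qed

text \<open>Telescoping: the equation turns the \<open>t\<close>-th expected reward into
  \<open>g\<close> plus a difference of consecutive values of \<open>K^t h\<close>.\<close>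

lemma poisson_sum:
  assumes "\<And>x. r x + chain_op K h x = g + h x"
  shows "(\<Sum>t<T. (chain_op K ^^ t) r x) = real T * g + h x - (chain_op K ^^ T) h x"
proof (induction T)
  case (Suc T)
  have "r = (\<lambda>x. (g + h x) - chain_op K h x)" using assms by (auto simp: fun_eq_iff algebra_simps)
  then have "(chain_op K ^^ T) r x = (chain_op K ^^ T) (\<lambda>x. (g + h x) - chain_op K h x) x" by simp
  also have "\<dots> = g + (chain_op K ^^ T) h x - (chain_op K ^^ T) (chain_op K h) x"
    by (simp add: chain_op_pow_diff chain_op_pow_add chain_op_pow_const)
  finally show ?case using Suc by (simp add: funpow_swap1 algebra_simps)
qed simp

lemma chain_op_pow_bounded:
  assumes "\<And>x. \<bar>u x\<bar> \<le> B" shows "\<bar>(chain_op K ^^ t) u x\<bar> \<le> B"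
proof -
  have "(chain_op K ^^ t) u x \<le> (chain_op K ^^ t) (\<lambda>_. B) x"
    "(chain_op K ^^ t) (\<lambda>_. -B) x \<le> (chain_op K ^^ t) u x"
    using assms by (auto intro!: chain_op_pow_mono simp: abs_le_iff minus_le_iff)
  then show ?thesis by (simp add: chain_op_pow_const abs_le_iff)
qed

lemma bounded_over_linear_tendsto_0:
  assumes "\<And>n. \<bar>u n\<bar> \<le> B" shows "(\<lambda>n. u n / real n) \<longlonglongrightarrow> 0"
proof (rule Lim_null_comparison)
  show "\<forall>\<^sub>F n in sequentially. norm (u n / real n) \<le> B / real n"
    using assms by (intro always_eventually) (auto intro!: divide_right_mono)
  show "(\<lambda>n. B / real n) \<longlonglongrightarrow> 0" by (rule lim_const_over_n)
qed

text \<open>The remainder in \<open>poisson_sum\<close> is bounded uniformly in \<open>T\<close>, so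
  it vanishes after division by \<open>T\<close>. This convergence does not depend on the period of
  the chain.\<close>

lemma poisson_average:
  assumes "\<And>x. r x + chain_op K h x = g + h x"
  shows "(\<lambda>T. (\<Sum>t<T. (chain_op K ^^ t) r x) / real T) \<longlonglongrightarrow> g"
proof -
  obtain B where B: "\<And>x. \<bar>h x\<bar> \<le> B"
    using that[of "Max (range (\<lambda>x. \<bar>h x\<bar>))"] by auto
  have "(\<lambda>T. (h x - (chain_op K ^^ T) h x) / real T) \<longlonglongrightarrow> 0"
  proof (rule bounded_over_linear_tendsto_0)
    show "\<bar>h x - (chain_op K ^^ T) h x\<bar> \<le> 2 * B" for T
      using B[of x] chain_op_pow_bounded[where u=h and B=B and K=K and t=T and x=x, OF B] by (simp add: abs_le_iff)
  qed
  then have "(\<lambda>T. g + (h x - (chain_op K ^^ T) h x) / real T) \<longlonglongrightarrow> g + 0"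
    by (intro tendsto_intros)
  moreover have "\<forall>\<^sub>F T in sequentially. g + (h x - (chain_op K ^^ T) h x) / real T =
      (\<Sum>t<T. (chain_op K ^^ t) r x) / real T"
    using eventually_gt_at_top[of "0::nat"]
    by eventually_elim (simp add: poisson_sum[OF assms] field_simps)
  ultimately show ?thesis by (auto intro: Lim_transform_eventually)
qed

text \<open>The centred partial sum is \<open>h x - (K^T h) x\<close>, which need not converge for a
  periodic chain. Its averages do: a second Poisson equation, with \<open>h\<close> as reward, shows
  that the averages of \<open>K^T h\<close> tend to a constant \<open>c\<close>.\<close>

lemma poisson_cesaro:
  assumes irr: "irreducible_chain K" and P: "\<And>x. r x + chain_op K h x = g + h x"
  shows "\<exists>c. \<forall>x. (\<lambda>N. (\<Sum>T=1..N. (\<Sum>t<T. (chain_op K ^^ t) r x) - real T * g) / real N) \<longlonglongrightarrow> h x - c"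
proof -
  obtain c k where k: "\<And>x. h x + chain_op K k x = c + k x"
    using poisson_equation_solvable[OF irr, of h] by metis
  show ?thesis
  proof (intro exI[of _ c] allI)
    fix x
    \<comment> \<open>The Cesaro sum runs over \<open>1..N\<close> while
      \<open>poisson_average\<close> sums over \<open>t < N\<close>; the last bracket corrects this
      shift and is bounded.\<close>
    have sums: "(\<Sum>T=1..N. (\<Sum>t<T. (chain_op K ^^ t) r x) - real T * g)
      = real N * h x - (\<Sum>t<N. (chain_op K ^^ t) h x) + (h x - (chain_op K ^^ N) h x)" for N
    proof (induction N)
      case (Suc N)
      have "(\<Sum>T=1..Suc N. (\<Sum>t<T. (chain_op K ^^ t) r x) - real T * g) =
        (\<Sum>T=1..N. (\<Sum>t<T. (chain_op K ^^ t) r x) - real T * g) + ((\<Sum>t<Suc N. (chain_op K ^^ t) r x) - real (Suc N) * g)"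
        by simp
      also have "\<dots> = real N * h x - (\<Sum>t<N. (chain_op K ^^ t) h x) + (h x - (chain_op K ^^ N) h x) + (h x - (chain_op K ^^ Suc N) h x)"
        by (simp only: Suc poisson_sum[OF P, where T="Suc N"])
      finally show ?case by (simp add: algebra_simps)
    qed simp
    obtain B where B: "\<And>x. \<bar>h x\<bar> \<le> B"
      using that[of "Max (range (\<lambda>x. \<bar>h x\<bar>))"] by auto
    have "(\<lambda>N. (h x - (chain_op K ^^ N) h x) / real N) \<longlonglongrightarrow> 0"
    proof (rule bounded_over_linear_tendsto_0)
      show "\<bar>h x - (chain_op K ^^ T) h x\<bar> \<le> 2 * B" for T
        using B[of x] chain_op_pow_bounded[where u=h and B=B and K=K and t=T and x=x, OF B] by (simp add: abs_le_iff)
    qed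
    then have "(\<lambda>N. h x - (\<Sum>t<N. (chain_op K ^^ t) h x) / real N + (h x - (chain_op K ^^ N) h x) / real N)
       \<longlonglongrightarrow> h x - c + 0"
      by (intro tendsto_intros poisson_average[OF k])
    moreover have "\<forall>\<^sub>F N in sequentially. h x - (\<Sum>t<N. (chain_op K ^^ t) h x) / real N + (h x - (chain_op K ^^ N) h x) / real N
       = (\<Sum>T=1..N. (\<Sum>t<T. (chain_op K ^^ t) r x) - real T * g) / real N"
      using eventually_gt_at_top[of "0::nat"]
      by eventually_elim (simp only: sums, simp add: field_simps)
    ultimately show "(\<lambda>N. (\<Sum>T=1..N. (\<Sum>t<T. (chain_op K ^^ t) r x) - real T * g) / real N) \<longlonglongrightarrow> h x - c"
      by (auto intro: Lim_transform_eventually)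
  qed
qed

text \<open>Policy improvement: if \<open>g' \<le> g\<close>, then \<open>h' - h\<close> is
  superharmonic, hence constant, which contradicts the strict inequality at
  \<open>z\<close>.\<close>

lemma poisson_gain_less:
  assumes irr: "irreducible_chain K"
    and P: "\<And>x. r x + chain_op K h' x = g' + h' x"
    and ge: "\<And>x. g + h x \<le> r x + chain_op K h x"
    and strict: "g + h z < r z + chain_op K h z"
  shows "g < g'"
proof (rule ccontr)
  assume "\<not> g < g'"
  define d where "d = (\<lambda>x. h' x - h x)"
  have eq: "d x - chain_op K d x = (r x + chain_op K h x - (g + h x)) + (g - g')" for x
    using P[of x] by (simp add: d_def chain_op_diff algebra_simps)
  have "chain_op K d x \<le> d x" for x
    using eq[of x] ge[of x] \<open>\<not> g < g'\<close> by linarith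
  note const = superharmonic_constant[OF irr this]
  have "d = (\<lambda>_. d z)" using const by auto
  then have "chain_op K d z = d z" by (metis chain_op_const)
  with eq[of z] strict \<open>\<not> g < g'\<close> show False by linarith
qed

section \<open>Expectations along trajectories\<close>

text \<open>The limit is specified on finite index sets \<open>J\<close> through the prefix of
  length \<open>up_to J\<close>. For an initial segment that prefix is \<open>J\<close> itself, so
  the marginal is the \<open>n\<close>-fold composition of kernels.\<close>

lemma (in Ionescu_Tulcea) distr_lim_Ico:
  "distr PF.lim (PiM {0..<n} M) (\<lambda>\<omega>. restrict \<omega> {0..<n}) = C 0 n (\<lambda>_. undefined)"
proof -
  have "up_to {0..<n} \<le> n" by (subst up_to_iff_Ico) auto
  moreover have "{0..<n} \<subseteq> {0..<up_to {0..<n}}" by (rule up_to) simp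
  ultimately have "up_to {0..<n} = n" by auto
  then show ?thesis
    using distr_C[of n n "\<lambda>_. undefined" 0] by (simp add: distr_lim CI_def)
qed

lemma (in Ionescu_Tulcea) prob_space_lim: "prob_space PF.lim"
proof (rule prob_space_distrD)
  show "(\<lambda>\<omega>. restrict \<omega> {0..<0}) \<in> PF.lim \<rightarrow>\<^sub>M PiM {0..<0} M"
    by (subst measurable_cong_sets[OF PF.sets_lim refl]) (auto intro!: measurable_restrict_subset)
  show "prob_space (distr PF.lim (PiM {0..<0} M) (\<lambda>\<omega>. restrict \<omega> {0..<0}))"
    unfolding distr_lim_Ico by (rule prob_space_C) simp
qed

text \<open>Tower property: given the first \<open>n\<close> coordinates, the next one has law
  \<open>P n\<close>. The law of \<open>n + 1\<close> coordinates is a bind of \<open>C 0 n\<close>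
  with \<open>eP n\<close>, and boundedness of \<open>f\<close> permits exchanging bind and Bochner
  integral.\<close>

lemma (in Ionescu_Tulcea) integral_lim_component:
  fixes f :: "'a \<Rightarrow> real"
  assumes f[measurable]: "f \<in> borel_measurable (M n)" and B: "\<And>z. z \<in> space (M n) \<Longrightarrow> \<bar>f z\<bar> \<le> B"
  shows "(\<integral>\<omega>. f (\<omega> n) \<partial>PF.lim) = (\<integral>\<omega>. (\<integral>z. f z \<partial>P n (restrict \<omega> {0..<n})) \<partial>PF.lim)"
proof -
  have restr[measurable]: "(\<lambda>\<omega>. restrict \<omega> {0..<k}) \<in> PF.lim \<rightarrow>\<^sub>M PiM {0..<k} M" for k
    by (subst measurable_cong_sets[OF PF.sets_lim refl]) (auto intro!: measurable_restrict_subset)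
  have u: "(\<lambda>_. undefined) \<in> space (PiM {0..<0} M)" by simp
  interpret C: prob_space "C 0 n (\<lambda>_. undefined)" by (rule prob_space_C[OF u])
  have comp[measurable]: "(\<lambda>\<omega>. f (\<omega> n)) \<in> borel_measurable (PiM {0..<Suc n} M)"
    using f by (intro measurable_compose[where f="\<lambda>\<omega>. \<omega> n" and g=f and N="M n"] measurable_component_singleton) auto
  have sC: "sets (C 0 n (\<lambda>_. undefined)) = sets (PiM {0..<n} M)"
    using sets_C[OF u, of n] by simp
  have "(\<integral>\<omega>. f (\<omega> n) \<partial>PF.lim) = (\<integral>\<omega>. f (restrict \<omega> {0..<Suc n} n) \<partial>PF.lim)" by simp
  also have "\<dots> = (\<integral>\<omega>. f (\<omega> n) \<partial>C 0 (Suc n) (\<lambda>_. undefined))"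
    by (subst distr_lim_Ico[symmetric], subst integral_distr) (auto intro: restr comp)
  also have "\<dots> = (\<integral>\<omega>. (\<integral>\<omega>'. f (\<omega>' n) \<partial>eP n \<omega>) \<partial>C 0 n (\<lambda>_. undefined))"
    unfolding C.simps add_0
  proof (rule integral_bind[where K="PiM {0..<Suc n} M" and B'=1 and B=B])
    show "eP n \<in> C 0 n (\<lambda>_. undefined) \<rightarrow>\<^sub>M subprob_algebra (Pi\<^sub>M {0..<Suc n} M)"
      by (subst measurable_cong_sets[OF sC refl]) measurable
    show "AE x in C 0 n (\<lambda>_. undefined). emeasure (eP n x) (space (eP n x)) \<le> ennreal 1"
    proof (rule AE_I2)
      fix x assume "x \<in> space (C 0 n (\<lambda>_. undefined))"
      then have "prob_space (eP n x)" using sets_eq_imp_space_eq[OF sC] by (intro prob_space_eP) simp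
      then show "emeasure (eP n x) (space (eP n x)) \<le> ennreal 1"
        by (simp add: prob_space.emeasure_space_1)
    qed
    show "\<bar>f (x n)\<bar> \<le> B" if "x \<in> space (PiM {0..<Suc n} M)" for x
      using that by (intro B) (auto simp: space_PiM PiE_iff)
  qed (auto intro: comp C.finite_measure_axioms)
  also have "\<dots> = (\<integral>\<omega>. (\<integral>z. f z \<partial>P n \<omega>) \<partial>C 0 n (\<lambda>_. undefined))"
  proof (intro Bochner_Integration.integral_cong refl)
    fix \<omega> assume "\<omega> \<in> space (C 0 n (\<lambda>_. undefined))"
    then have \<omega>: "\<omega> \<in> space (PiM {0..<n} M)" using sets_eq_imp_space_eq[OF sC] by simp
    have "fun_upd \<omega> n \<in> P n \<omega> \<rightarrow>\<^sub>M PiM {0..<Suc n} M"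
      unfolding measurable_cong_sets[OF sets_P[OF \<omega>] refl]
      using \<omega> by (intro measurable_fun_upd[where J="{0..<n}"]) auto
    then show "(\<integral>\<omega>'. f (\<omega>' n) \<partial>eP n \<omega>) = (\<integral>z. f z \<partial>P n \<omega>)"
      unfolding eP_def by (subst integral_distr) (auto intro: comp)
  qed
  also have "\<dots> = (\<integral>\<omega>. (\<integral>z. f z \<partial>P n (restrict \<omega> {0..<n})) \<partial>PF.lim)"
    by (subst distr_lim_Ico[symmetric], subst integral_distr)
      (auto intro: restr measurable_compose[OF P integral_measurable_subprob_algebra[OF f]])
  finally show ?thesis .
qed

abbreviation action_at :: "(nat \<Rightarrow> 's \<times> 'a \<times> real) \<Rightarrow> nat \<Rightarrow> 'a" where
  "action_at \<omega> t \<equiv> fst (snd (\<omega> t))"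

lemma stationary_in_policies: "stationary f \<in> policies"
  by (simp add: policies_def stationary_def)

section \<open>One-step expectations in an MDP\<close>

locale unstructured_mdp =
  fixes lam :: "real measure" and \<phi> :: "('s::finite, 'a::finite) mdp"
  assumes sets_lam: "sets lam = sets unit_borel" and in_unstructured: "\<phi> \<in> unstructured lam"
begin

lemma sets_rew: "sets (rew \<phi> y a) = sets unit_borel"
proof -
  obtain f where "rew \<phi> y a = density lam f"
    using in_unstructured by (auto simp: unstructured_def reward_laws_def)
  then show ?thesis by (simp add: sets_lam)
qed

lemma prob_space_rew: "prob_space (rew \<phi> y a)"
  using in_unstructured by (auto simp: unstructured_def reward_laws_def)

lemma space_rew: "space (rew \<phi> y a) = {0..1}"
  using sets_eq_imp_space_eq[OF sets_rew] by (simp add: space_restrict_space)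

lemma measurable_step [measurable]: "(\<lambda>r. (y, a, r)) \<in> rew \<phi> y a \<rightarrow>\<^sub>M step_space"
  unfolding measurable_cong_sets[OF sets_rew refl] by measurable

lemma space_step_space: "space (step_space :: ('s \<times> 'a \<times> real) measure) = UNIV \<times> UNIV \<times> {0..1}"
  by (simp add: space_pair_measure space_restrict_space)

text \<open>The two outer binds range over finite types and become finite sums; only the reward
  remains an integral.\<close>

lemma integral_step_kernel:
  fixes v :: "'s \<times> 'a \<times> real \<Rightarrow> real"
  assumes v[measurable]: "v \<in> borel_measurable step_space"
    and B: "\<And>z. z \<in> space step_space \<Longrightarrow> \<bar>v z\<bar> \<le> B"
  shows "(\<integral>z. v z \<partial>step_kernel \<phi> \<pi> x t \<omega>) =
    (\<Sum>y\<in>UNIV. pmf (if t = 0 then return_pmf x else case \<omega> (t - 1) of (y, a, r) \<Rightarrow> trans \<phi> y a) y *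
      (\<Sum>a\<in>UNIV. pmf (\<pi> t \<omega> y) a * (\<integral>r. v (y, a, r) \<partial>rew \<phi> y a)))"
proof -
  let ?D = "\<lambda>y a. distr (rew \<phi> y a) step_space (\<lambda>r. (y, a, r))"
  have D: "?D y a \<in> space (prob_algebra step_space)" for y a
    using prob_space.prob_space_distr[OF prob_space_rew measurable_step]
    by (auto simp: space_prob_algebra)
  have D': "?D y \<in> measure_pmf p \<rightarrow>\<^sub>M prob_algebra step_space" for y and p :: "'a pmf"
    using D by simp
  have inner: "(\<integral>z. v z \<partial>(measure_pmf p \<bind> ?D y)) = (\<Sum>a\<in>UNIV. pmf p a * (\<integral>r. v (y, a, r) \<partial>rew \<phi> y a))"
    for y and p :: "'a pmf"
  proof -
    have "(\<integral>z. v z \<partial>(measure_pmf p \<bind> ?D y)) = (\<integral>a. (\<integral>z. v z \<partial>?D y a) \<partial>measure_pmf p)"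
    proof (rule integral_bind[where K=step_space and B'=1 and B=B])
      show "?D y \<in> measure_pmf p \<rightarrow>\<^sub>M subprob_algebra step_space"
        using D' by (rule measurable_prob_algebraD)
      have "emeasure (?D y a) (space (?D y a)) = 1" for a
        using D by (intro prob_space.emeasure_space_1) (auto simp: space_prob_algebra)
      then show "AE a in measure_pmf p. emeasure (?D y a) (space (?D y a)) \<le> ennreal 1"
        by (intro AE_I2) (simp only: ennreal_1 order_refl)
    qed (use B v in \<open>auto intro: measure_pmf.finite_measure_axioms\<close>)
    also have "\<dots> = (\<Sum>a\<in>UNIV. pmf p a * (\<integral>z. v z \<partial>?D y a))"
      by (subst integral_measure_pmf[where A=UNIV]) auto
    also have "\<dots> = (\<Sum>a\<in>UNIV. pmf p a * (\<integral>r. v (y, a, r) \<partial>rew \<phi> y a))"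
      by (subst integral_distr) auto
    finally show ?thesis .
  qed
  let ?E = "\<lambda>y. measure_pmf (\<pi> t \<omega> y) \<bind> ?D y"
  have E: "?E y \<in> space (prob_algebra step_space)" for y
  proof -
    have M: "measure_pmf (\<pi> t \<omega> y) \<in> space (prob_algebra (measure_pmf (\<pi> t \<omega> y)))"
      by (simp add: space_prob_algebra measure_pmf.prob_space_axioms)
    show ?thesis
      using prob_space_bind'[OF M D'] sets_bind'[OF M D'] by (simp add: space_prob_algebra)
  qed
  have "(\<integral>z. v z \<partial>(measure_pmf q \<bind> ?E)) =
      (\<Sum>y\<in>UNIV. pmf q y * (\<Sum>a\<in>UNIV. pmf (\<pi> t \<omega> y) a * (\<integral>r. v (y, a, r) \<partial>rew \<phi> y a)))" for q :: "'s pmf"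
  proof -
    have "(\<integral>z. v z \<partial>(measure_pmf q \<bind> ?E)) = (\<integral>y. (\<integral>z. v z \<partial>?E y) \<partial>measure_pmf q)"
    proof (rule integral_bind[where K=step_space and B'=1 and B=B])
      have "?E \<in> measure_pmf q \<rightarrow>\<^sub>M prob_algebra step_space" using E by simp
      then show "?E \<in> measure_pmf q \<rightarrow>\<^sub>M subprob_algebra step_space"
        by (rule measurable_prob_algebraD)
      have "emeasure (?E y) (space (?E y)) = 1" for y
        using E by (intro prob_space.emeasure_space_1) (auto simp: space_prob_algebra)
      then show "AE y in measure_pmf q. emeasure (?E y) (space (?E y)) \<le> ennreal 1"
        by (intro AE_I2) (simp only: ennreal_1 order_refl)
    qed (use B v in \<open>auto intro: measure_pmf.finite_measure_axioms\<close>)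
    also have "\<dots> = (\<Sum>y\<in>UNIV. pmf q y * (\<integral>z. v z \<partial>?E y))"
      by (subst integral_measure_pmf[where A=UNIV]) auto
    finally show ?thesis by (simp add: inner)
  qed
  then show ?thesis unfolding step_kernel_def .
qed

context
  fixes \<pi> :: "('s, 'a) policy" and x :: 's
  assumes \<pi>: "\<pi> \<in> policies"
begin

interpretation IT: Ionescu_Tulcea "step_kernel \<phi> \<pi> x" "\<lambda>_. step_space"
  by (rule Ionescu_Tulcea_step_kernel[OF sets_lam in_unstructured \<pi>])

lemma prob_space_traj: "prob_space (traj \<phi> \<pi> x)"
  unfolding traj_def by (rule IT.prob_space_lim)

lemma sets_traj: "sets (traj \<phi> \<pi> x) = sets (PiM UNIV (\<lambda>_. step_space))"
  unfolding traj_def by (rule IT.PF.sets_lim)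

lemma measurable_component_traj: "(\<lambda>\<omega>. \<omega> t) \<in> traj \<phi> \<pi> x \<rightarrow>\<^sub>M step_space"
  by (subst measurable_cong_sets[OF sets_traj refl]) (auto intro: measurable_component_singleton)

lemma traj_component_in_space: "\<omega> \<in> space (traj \<phi> \<pi> x) \<Longrightarrow> \<omega> t \<in> space step_space"
  using measurable_space[OF measurable_component_traj] .

lemma integrable_traj_component:
  fixes v :: "'s \<times> 'a \<times> real \<Rightarrow> real"
  assumes "v \<in> borel_measurable step_space" and "\<And>z. z \<in> space step_space \<Longrightarrow> \<bar>v z\<bar> \<le> B"
  shows "integrable (traj \<phi> \<pi> x) (\<lambda>\<omega>. v (\<omega> t))"
proof -
  interpret prob_space "traj \<phi> \<pi> x" by (rule prob_space_traj)
  show ?thesis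
    using assms traj_component_in_space
    by (intro integrable_const_bound[where B=B] measurable_compose[OF measurable_component_traj] AE_I2) auto
qed

text \<open>Conditioning on the past: the state is drawn from the transition law, then the action,
  then the reward. The identities for rewards, states and actions below are obtained by choosing a
  bounded \<open>v\<close>.\<close>

lemma integral_traj_component:
  fixes v :: "'s \<times> 'a \<times> real \<Rightarrow> real"
  assumes "v \<in> borel_measurable step_space" and "\<And>z. z \<in> space step_space \<Longrightarrow> \<bar>v z\<bar> \<le> B"
  shows "(\<integral>\<omega>. v (\<omega> t) \<partial>traj \<phi> \<pi> x) = (\<integral>\<omega>.
    (\<Sum>y\<in>UNIV. pmf (if t = 0 then return_pmf x else trans \<phi> (state_at \<omega> (t - 1)) (action_at \<omega> (t - 1))) y *
      (\<Sum>a\<in>UNIV. pmf (\<pi> t (restrict \<omega> {0..<t}) y) a * (\<integral>r. v (y, a, r) \<partial>rew \<phi> y a))) \<partial>traj \<phi> \<pi> x)"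
  unfolding traj_def
  by (subst IT.integral_lim_component[OF assms])
    (auto simp: integral_step_kernel[OF assms] state_at_def case_prod_beta intro!: Bochner_Integration.integral_cong sum.cong)

end

end

lemma finite_family_bounded:
  fixes w :: "'x::finite \<Rightarrow> real"
  obtains B where "\<And>x. \<bar>w x\<bar> \<le> B"
  using that[of "Max (range (\<lambda>x. \<bar>w x\<bar>))"] by auto

lemma measurable_state_action:
  fixes w :: "'s::finite \<Rightarrow> 'a::finite \<Rightarrow> real"
  shows "(\<lambda>z. w (fst z) (fst (snd z))) \<in> borel_measurable step_space"
proof -
  have "(\<lambda>z. (fst z, fst (snd z))) \<in> step_space \<rightarrow>\<^sub>M (count_space (UNIV :: ('s \<times> 'a) set))"
    by (simp add: pair_measure_countable[symmetric] countable_finite)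
  from measurable_compose[OF this, of "\<lambda>z. w (fst z) (snd z)" borel] show ?thesis by simp
qed

lemma measurable_reward: "(\<lambda>z. snd (snd z)) \<in> borel_measurable step_space"
proof -
  have "(\<lambda>r. r) \<in> borel_measurable unit_borel" by (simp add: measurable_restrict_space1)
  then show ?thesis by (rule measurable_compose[rotated]) simp
qed

definition policy_kernel :: "('s, 'a) mdp \<Rightarrow> ('s \<Rightarrow> 'a) \<Rightarrow> 's \<Rightarrow> 's pmf" where
  "policy_kernel \<phi> f y = trans \<phi> y (f y)"

text \<open>Evaluating a policy by a Bellman equation is solving the Poisson equation of its
  chain.\<close>

lemma bellman_policy:
  "bellman \<phi> (f y) h y = mean_reward \<phi> y (f y) + chain_op (policy_kernel \<phi> f) h y"
  by (simp add: bellman_def chain_op_def policy_kernel_def)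

context unstructured_mdp
begin

context
  fixes \<pi> :: "('s, 'a) policy" and x :: 's
  assumes \<pi>: "\<pi> \<in> policies"
begin

lemma integral_traj_component_eq_0:
  fixes v :: "'s \<times> 'a \<times> real \<Rightarrow> real"
  assumes "v \<in> borel_measurable step_space" and "\<And>z. z \<in> space step_space \<Longrightarrow> \<bar>v z\<bar> \<le> B"
    and "\<And>y a. (\<integral>r. v (y, a, r) \<partial>rew \<phi> y a) = 0"
  shows "(\<integral>\<omega>. v (\<omega> t) \<partial>traj \<phi> \<pi> x) = 0"
  by (subst integral_traj_component[OF \<pi> assms(1,2)]) (simp_all add: assms(3))

lemma integrable_traj_state_action: "integrable (traj \<phi> \<pi> x) (\<lambda>\<omega>. w (state_at \<omega> t) (action_at \<omega> t))"
  for w :: "'s \<Rightarrow> 'a \<Rightarrow> real"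
proof -
  obtain B where B: "\<And>z. \<bar>w (fst z) (snd z)\<bar> \<le> B"
    using finite_family_bounded[of "\<lambda>z. w (fst z) (snd z)"] by metis
  have B': "\<bar>w y a\<bar> \<le> B" for y a using B[of "(y, a)"] by simp
  show ?thesis
    using integrable_traj_component[OF \<pi> measurable_state_action[of w], of B] B' by (simp add: state_at_def)
qed

lemma integrable_traj_reward: "integrable (traj \<phi> \<pi> x) (\<lambda>\<omega>. reward_at \<omega> t)"
  unfolding reward_at_def
  by (rule integrable_traj_component[OF \<pi> measurable_reward, of 1]) (auto simp: space_step_space)

text \<open>The reward minus its mean given state and action integrates to 0 against every reward
  law.\<close>

lemma integral_traj_reward:
  "(\<integral>\<omega>. reward_at \<omega> t \<partial>traj \<phi> \<pi> x) = (\<integral>\<omega>. mean_reward \<phi> (state_at \<omega> t) (action_at \<omega> t) \<partial>traj \<phi> \<pi> x)"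
proof -
  obtain B where B: "\<And>z. \<bar>mean_reward \<phi> (fst z) (snd z)\<bar> \<le> B"
    using finite_family_bounded[of "\<lambda>z. mean_reward \<phi> (fst z) (snd z)"] by metis
  have B': "\<bar>mean_reward \<phi> y a\<bar> \<le> B" for y a using B[of "(y, a)"] by simp
  let ?v = "\<lambda>z. snd (snd z) - mean_reward \<phi> (fst z) (fst (snd z))"
  have "(\<integral>\<omega>. ?v (\<omega> t) \<partial>traj \<phi> \<pi> x) = 0"
  proof (rule integral_traj_component_eq_0[where B="1 + B"])
    show "?v \<in> borel_measurable step_space"
      by (intro borel_measurable_diff measurable_reward measurable_state_action)
    show "\<bar>?v z\<bar> \<le> 1 + B" if "z \<in> space step_space" for z
      using that B'[of "fst z" "fst (snd z)"] by (auto simp: space_step_space abs_le_iff)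
    fix y a
    interpret prob_space "rew \<phi> y a" by (rule prob_space_rew)
    have "(\<lambda>r. r) \<in> borel_measurable (rew \<phi> y a)"
      unfolding measurable_cong_sets[OF sets_rew refl] by (simp add: measurable_restrict_space1)
    then have "integrable (rew \<phi> y a) (\<lambda>r. r)"
      by (intro integrable_const_bound[where B=1] AE_I2) (auto simp: space_rew)
    then show "(\<integral>r. ?v (y, a, r) \<partial>rew \<phi> y a) = 0"
      using prob_space by (simp add: mean_reward_def)
  qed
  moreover have "(\<integral>\<omega>. ?v (\<omega> t) \<partial>traj \<phi> \<pi> x) = (\<integral>\<omega>. reward_at \<omega> t \<partial>traj \<phi> \<pi> x) -
      (\<integral>\<omega>. mean_reward \<phi> (state_at \<omega> t) (action_at \<omega> t) \<partial>traj \<phi> \<pi> x)"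
    using integrable_traj_reward[of t] integrable_traj_state_action[of "mean_reward \<phi>" t]
    by (simp add: reward_at_def state_at_def)
  ultimately show ?thesis by simp
qed

lemma integral_traj_state:
  fixes u :: "'s \<Rightarrow> real"
  shows "(\<integral>\<omega>. u (state_at \<omega> t) \<partial>traj \<phi> \<pi> x) = (\<integral>\<omega>.
    (\<Sum>y\<in>UNIV. pmf (if t = 0 then return_pmf x else trans \<phi> (state_at \<omega> (t - 1)) (action_at \<omega> (t - 1))) y * u y)
      \<partial>traj \<phi> \<pi> x)"
proof -
  obtain B where B: "\<And>z. \<bar>u z\<bar> \<le> B" using finite_family_bounded[of u] by metis
  have "(\<Sum>a\<in>UNIV. pmf p a * c) = c" for p :: "'a pmf" and c :: real
    by (simp add: sum_distrib_right[symmetric])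
  then show ?thesis
    unfolding state_at_def[of _ t]
    by (subst integral_traj_component[OF \<pi> measurable_state_action[of "\<lambda>y a. u y"] B])
      (simp add: prob_space.prob_space[OF prob_space_rew])
qed

lemma integral_traj_state_0: "(\<integral>\<omega>. u (state_at \<omega> 0) \<partial>traj \<phi> \<pi> x) = (u x :: real)"
proof -
  have "(\<Sum>y\<in>UNIV. pmf (return_pmf x) y * u y) = (\<Sum>y\<in>UNIV. if y = x then u y else 0)"
    by (intro sum.cong) (auto simp: indicator_def)
  then have "(\<Sum>y\<in>UNIV. pmf (return_pmf x) y * u y) = u x" by simp
  then show ?thesis
    using prob_space.prob_space[OF prob_space_traj[OF \<pi>]] by (subst integral_traj_state) simp
qed

lemma integral_traj_state_Suc:
  "(\<integral>\<omega>. u (state_at \<omega> (Suc t)) \<partial>traj \<phi> \<pi> x) =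
    (\<integral>\<omega>. (\<Sum>y\<in>UNIV. pmf (trans \<phi> (state_at \<omega> t) (action_at \<omega> t)) y * (u y :: real)) \<partial>traj \<phi> \<pi> x)"
  by (subst integral_traj_state) simp

section \<open>Upper bounds on the average reward of an arbitrary policy\<close>

lemma avg_reward_eq_sum:
  "avg_reward \<phi> \<pi> x T = (\<Sum>t<T. \<integral>\<omega>. reward_at \<omega> t \<partial>traj \<phi> \<pi> x) / real T"
  by (simp add: avg_reward_def integrable_traj_reward)

text \<open>Supermartingale argument: by \<open>le\<close>, one step yields an expected reward of at
  most \<open>g\<close> plus the expected decrease of \<open>h\<close>, and these decreases
  telescope. The bound holds for each state-action pair, so dependence of the actions on the history
  does no harm.\<close>

lemma expected_reward_sum_le:
  assumes le: "\<And>y a. bellman \<phi> a h y \<le> g + h y"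
  shows "(\<Sum>t<T. \<integral>\<omega>. reward_at \<omega> t \<partial>traj \<phi> \<pi> x)
    \<le> real T * g + h x - (\<integral>\<omega>. h (state_at \<omega> T) \<partial>traj \<phi> \<pi> x)"
proof (induction T)
  case 0
  show ?case by (simp add: integral_traj_state_0)
next
  case (Suc T)
  let ?P = "\<lambda>y a. \<Sum>z\<in>UNIV. pmf (trans \<phi> y a) z * h z"
  interpret prob_space "traj \<phi> \<pi> x" by (rule prob_space_traj[OF \<pi>])
  have "(\<integral>\<omega>. reward_at \<omega> T \<partial>traj \<phi> \<pi> x) + (\<integral>\<omega>. h (state_at \<omega> (Suc T)) \<partial>traj \<phi> \<pi> x)
    = (\<integral>\<omega>. mean_reward \<phi> (state_at \<omega> T) (action_at \<omega> T) + ?P (state_at \<omega> T) (action_at \<omega> T) \<partial>traj \<phi> \<pi> x)"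
    unfolding integral_traj_reward integral_traj_state_Suc
    by (rule Bochner_Integration.integral_add[symmetric]) (rule integrable_traj_state_action)+
  also have "\<dots> \<le> (\<integral>\<omega>. g + h (state_at \<omega> T) \<partial>traj \<phi> \<pi> x)"
  proof (rule integral_mono)
    show "integrable (traj \<phi> \<pi> x) (\<lambda>\<omega>. mean_reward \<phi> (state_at \<omega> T) (action_at \<omega> T) + ?P (state_at \<omega> T) (action_at \<omega> T))"
      by (rule Bochner_Integration.integrable_add) (rule integrable_traj_state_action)+
    show "integrable (traj \<phi> \<pi> x) (\<lambda>\<omega>. g + h (state_at \<omega> T))"
      by (rule integrable_traj_state_action[of "\<lambda>y a. g + h y"])
  qed (use le in \<open>simp add: bellman_def\<close>)
  also have "\<dots> = g + (\<integral>\<omega>. h (state_at \<omega> T) \<partial>traj \<phi> \<pi> x)"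
    using integrable_traj_state_action[of "\<lambda>y a. h y" T] prob_space by simp
  finally show ?case using Suc by (simp add: algebra_simps)
qed

lemma liminf_avg_reward_le:
  assumes le: "\<And>y a. bellman \<phi> a h y \<le> g + h y"
  shows "liminf (\<lambda>T. ereal (avg_reward \<phi> \<pi> x T)) \<le> ereal g"
proof -
  interpret prob_space "traj \<phi> \<pi> x" by (rule prob_space_traj[OF \<pi>])
  obtain B where B: "\<And>z. \<bar>h z\<bar> \<le> B" using finite_family_bounded[of h] by metis
  have lower: "- B \<le> (\<integral>\<omega>. h (state_at \<omega> T) \<partial>traj \<phi> \<pi> x)" for T
  proof -
    have "(\<integral>\<omega>. - B \<partial>traj \<phi> \<pi> x) \<le> (\<integral>\<omega>. h (state_at \<omega> T) \<partial>traj \<phi> \<pi> x)"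
      using integrable_traj_state_action[of "\<lambda>y a. h y" T] B
      by (intro integral_mono) (auto simp: abs_le_iff minus_le_iff)
    then show ?thesis using prob_space by simp
  qed
  have "avg_reward \<phi> \<pi> x T \<le> g + (2 * B) / real T" if "T > 0" for T
  proof -
    have "(\<Sum>t<T. \<integral>\<omega>. reward_at \<omega> t \<partial>traj \<phi> \<pi> x) \<le> real T * g + 2 * B"
      using expected_reward_sum_le[OF le, of T] lower[of T] B[of x] by (simp add: abs_le_iff)
    then have "avg_reward \<phi> \<pi> x T \<le> (real T * g + 2 * B) / real T"
      unfolding avg_reward_eq_sum by (intro divide_right_mono) auto
    then show ?thesis using that by (simp add: add_divide_distrib)
  qed
  then have "T > 0 \<Longrightarrow> ereal (avg_reward \<phi> \<pi> x T) \<le> ereal (g + (2 * B) / real T)" for T by simp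
  with eventually_gt_at_top[of "0::nat"]
  have "\<forall>\<^sub>F T in sequentially. ereal (avg_reward \<phi> \<pi> x T) \<le> ereal (g + (2 * B) / real T)"
    by (rule eventually_mono)
  then have "liminf (\<lambda>T. ereal (avg_reward \<phi> \<pi> x T)) \<le> liminf (\<lambda>T. ereal (g + (2 * B) / real T))"
    by (rule Liminf_mono)
  also have "(\<lambda>T. g + (2 * B) / real T) \<longlonglongrightarrow> g + 0"
    by (intro tendsto_intros lim_const_over_n)
  then have "liminf (\<lambda>T. ereal (g + (2 * B) / real T)) = ereal g"
    by (intro lim_imp_Liminf) (auto intro: tendsto_intros)
  finally show ?thesis .
qed

end

lemma opt_gain_le:
  assumes "\<And>y a. bellman \<phi> a h y \<le> g + h y"
  shows "opt_gain \<phi> x \<le> ereal g"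
  unfolding opt_gain_def by (intro SUP_least liminf_avg_reward_le[where h=h] assms)

section \<open>Stationary policies as Markov chains\<close>

context
  fixes f :: "'s \<Rightarrow> 'a" and x :: 's
begin

text \<open>The action is \<open>f\<close> of the state almost surely. In expectation this follows
  because \<open>w y a - w y (f y)\<close> sums to 0 against the point mass at
  \<open>f y\<close>.\<close>

lemma integral_traj_stationary_action:
  "(\<integral>\<omega>. w (state_at \<omega> t) (action_at \<omega> t) \<partial>traj \<phi> (stationary f) x)
    = (\<integral>\<omega>. (w (state_at \<omega> t) (f (state_at \<omega> t)) :: real) \<partial>traj \<phi> (stationary f) x)"
proof -
  let ?w = "\<lambda>y a. w y a - w y (f y)"
  obtain B where B: "\<And>z. \<bar>?w (fst z) (snd z)\<bar> \<le> B"
    using finite_family_bounded[of "\<lambda>z. ?w (fst z) (snd z)"] by metis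
  have B': "\<bar>?w y a\<bar> \<le> B" for y a using B[of "(y, a)"] by simp
  have "(\<Sum>a\<in>UNIV. pmf (stationary f t \<omega> y) a * (\<integral>r. ?w y a \<partial>rew \<phi> y a)) = 0" for \<omega> y
    by (intro sum.neutral) (auto simp: stationary_def indicator_def)
  then have "(\<integral>\<omega>. ?w (fst (\<omega> t)) (action_at \<omega> t) \<partial>traj \<phi> (stationary f) x) = 0"
    by (subst integral_traj_component[OF stationary_in_policies measurable_state_action[of ?w] B'])
      simp
  moreover have "(\<integral>\<omega>. ?w (fst (\<omega> t)) (action_at \<omega> t) \<partial>traj \<phi> (stationary f) x) =
    (\<integral>\<omega>. w (state_at \<omega> t) (action_at \<omega> t) \<partial>traj \<phi> (stationary f) x)
    - (\<integral>\<omega>. w (state_at \<omega> t) (f (state_at \<omega> t)) \<partial>traj \<phi> (stationary f) x)"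
    unfolding state_at_def[symmetric]
    by (rule Bochner_Integration.integral_diff)
      (rule integrable_traj_state_action[OF stationary_in_policies, where w=w]
        integrable_traj_state_action[OF stationary_in_policies, where w="\<lambda>y a. w y (f y)"])+
  ultimately show ?thesis by simp
qed

lemma integral_traj_stationary_state:
  "(\<integral>\<omega>. u (state_at \<omega> t) \<partial>traj \<phi> (stationary f) x) = (chain_op (policy_kernel \<phi> f) ^^ t) u x"
\<comment> \<open>Conditioning on the last step replaces \<open>u\<close> by its one-step
  expectation, hence the generalisation over \<open>u\<close>.\<close>
proof (induction t arbitrary: u)
  case 0
  show ?case by (simp add: integral_traj_state_0[OF stationary_in_policies])
next
  case (Suc t)
  have "(\<integral>\<omega>. u (state_at \<omega> (Suc t)) \<partial>traj \<phi> (stationary f) x)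
     = (\<integral>\<omega>. chain_op (policy_kernel \<phi> f) u (state_at \<omega> t) \<partial>traj \<phi> (stationary f) x)"
    unfolding integral_traj_state_Suc[OF stationary_in_policies]
    by (subst integral_traj_stationary_action[of "\<lambda>y a. \<Sum>z\<in>UNIV. pmf (trans \<phi> y a) z * u z"])
      (simp add: chain_op_def policy_kernel_def)
  then show ?case by (simp add: Suc funpow_swap1)
qed

lemma integral_traj_stationary_reward:
  "(\<integral>\<omega>. reward_at \<omega> t \<partial>traj \<phi> (stationary f) x)
    = (chain_op (policy_kernel \<phi> f) ^^ t) (\<lambda>y. mean_reward \<phi> y (f y)) x"
  unfolding integral_traj_reward[OF stationary_in_policies] integral_traj_stationary_action
  by (rule integral_traj_stationary_state)

lemma avg_reward_stationary:
  "avg_reward \<phi> (stationary f) x T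
    = (\<Sum>t<T. (chain_op (policy_kernel \<phi> f) ^^ t) (\<lambda>y. mean_reward \<phi> y (f y)) x) / real T"
  by (simp add: avg_reward_eq_sum[OF stationary_in_policies] integral_traj_stationary_reward)

lemma avg_reward_stationary_tendsto:
  assumes "\<And>y. bellman \<phi> (f y) h y = g + h y"
  shows "avg_reward \<phi> (stationary f) x \<longlonglongrightarrow> g"
  using poisson_average[OF assms[unfolded bellman_policy]]
  unfolding avg_reward_stationary[abs_def] .

lemma gain_eqI:
  assumes "\<And>y. bellman \<phi> (f y) h y = g + h y"
  shows "gain \<phi> f x = g"
  unfolding gain_def by (intro limI avg_reward_stationary_tendsto[OF assms])

lemma gain_le_opt_gain:
  assumes "\<And>y. bellman \<phi> (f y) h y = g + h y"
  shows "ereal g \<le> opt_gain \<phi> x"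
proof -
  have "liminf (\<lambda>T. ereal (avg_reward \<phi> (stationary f) x T)) = ereal g"
    by (intro lim_imp_Liminf) (auto intro: tendsto_intros avg_reward_stationary_tendsto[OF assms])
  then show ?thesis
    unfolding opt_gain_def by (metis SUP_upper stationary_in_policies)
qed

end

text \<open>Transfers \<open>ergodic\<close>, stated through trajectory measures, to the operator:
  the probability of a state is the expectation of its indicator.\<close>

lemma irreducible_policy_kernel:
  assumes "ergodic \<phi>" shows "irreducible_chain (policy_kernel \<phi> f)"
  unfolding irreducible_chain_def
proof (intro allI)
  fix x y
  let ?M = "traj \<phi> (stationary f) x"
  obtain t where t: "measure ?M {\<omega> \<in> space ?M. state_at \<omega> t = y} > 0"
    using assms unfolding ergodic_def by blast
  have "measure ?M {\<omega> \<in> space ?M. state_at \<omega> t = y} = (\<integral>\<omega>. indicator {y} (state_at \<omega> t) \<partial>?M)"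
  proof -
    have "(\<integral>\<omega>. indicator {y} (state_at \<omega> t) \<partial>?M)
      = (\<integral>\<omega>. indicator {\<omega> \<in> space ?M. state_at \<omega> t = y} \<omega> \<partial>?M)"
      by (intro Bochner_Integration.integral_cong) (auto simp: indicator_def)
    also have "\<dots> = measure ?M {\<omega> \<in> space ?M. state_at \<omega> t = y}"
      by simp (auto intro: arg_cong[where f="measure ?M"])
    finally show ?thesis ..
  qed
  with t have "(chain_op (policy_kernel \<phi> f) ^^ t) (indicator {y}) x > 0"
    by (simp add: integral_traj_stationary_state)
  then show "\<exists>t. (chain_op (policy_kernel \<phi> f) ^^ t) (indicator {y}) x > 0" ..
qed

end

section \<open>Kullback-Leibler divergence and expectations\<close>

text \<open>With the junk value \<open>ln 0 = 0\<close>, the hypothesis \<open>g = 0 \<longrightarrow> f = 0\<close> covers the boundary cases.\<close>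
lemma xlnx_lower_bound:
  fixes f g :: real
  assumes "0 \<le> f" "0 \<le> g" "g = 0 \<longrightarrow> f = 0"
  shows "f - g + (sqrt f - sqrt g)\<^sup>2 \<le> f * ln (f / g)"
proof (cases "f = 0")
  case True
  then show ?thesis using assms by simp
next
  case False
  then have f: "f > 0" and g: "g > 0" using assms by auto
  have "ln (sqrt g / sqrt f) \<le> sqrt g / sqrt f - 1"
    using f g by (intro ln_le_minus_one) simp
  then have "2 * f * (1 - sqrt g / sqrt f) \<le> 2 * f * (- ln (sqrt g / sqrt f))"
    using f by (intro mult_left_mono) auto
  also have "\<dots> = f * ln (f / g)"
    using f g by (simp add: ln_div ln_sqrt algebra_simps)
  finally have "2 * f * (1 - sqrt g / sqrt f) \<le> f * ln (f / g)" .
  moreover have "f * (sqrt g / sqrt f) = sqrt f * sqrt g"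
    using f by (simp add: field_simps)
  moreover have "(sqrt f - sqrt g)\<^sup>2 = f + g - 2 * (sqrt f * sqrt g)"
    using f g by (simp add: power2_diff)
  moreover have "2 * f * (1 - sqrt g / sqrt f) = 2 * f - 2 * (f * (sqrt g / sqrt f))"
    by (simp add: right_diff_distrib)
  ultimately show ?thesis by linarith
qed

text \<open>AM-GM for the factorisation \<open>f - g = (sqrt f - sqrt g) (sqrt f + sqrt g)\<close>.\<close>
lemma abs_diff_le_xlnx:
  fixes f g c :: real
  assumes "0 \<le> f" "0 \<le> g" "g = 0 \<longrightarrow> f = 0" "c > 0"
  shows "\<bar>f - g\<bar> \<le> (f * ln (f / g) - (f - g)) / (2 * c) + c * (f + g)"
proof -
  define a b where "a = sqrt f" and "b = sqrt g"
  have f: "f = a\<^sup>2" and g: "g = b\<^sup>2" and ab: "a \<ge> 0" "b \<ge> 0" using assms by (auto simp: a_def b_def)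
  have "\<bar>f - g\<bar> = \<bar>a - b\<bar> * (a + b)"
  proof -
    have "f - g = (a - b) * (a + b)" by (simp add: f g power2_eq_square algebra_simps)
    then show ?thesis using ab by (simp add: abs_mult)
  qed
  also have "\<dots> \<le> (a - b)\<^sup>2 / (2 * c) + c / 2 * (a + b)\<^sup>2"
  proof -
    have "0 \<le> (\<bar>a - b\<bar> - c * (a + b))\<^sup>2 / (2 * c)" using assms by simp
    also have "\<dots> = (a - b)\<^sup>2 / (2 * c) + c / 2 * (a + b)\<^sup>2 - \<bar>a - b\<bar> * (a + b)"
      using assms by (simp add: power2_diff field_simps power2_eq_square)
    finally show ?thesis by simp
  qed
  also have "\<dots> \<le> (a - b)\<^sup>2 / (2 * c) + c * (f + g)"
  proof -
    have "(a + b)\<^sup>2 \<le> 2 * (f + g)" using zero_le_power2[of "a - b"] by (simp add: f g power2_diff power2_sum)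
    then have "c / 2 * (a + b)\<^sup>2 \<le> c / 2 * (2 * (f + g))" using assms by (intro mult_left_mono) auto
    then show ?thesis by (simp add: algebra_simps)
  qed
  also have "(a - b)\<^sup>2 \<le> f * ln (f / g) - (f - g)"
    using xlnx_lower_bound[OF assms(1-3)] by (simp add: a_def b_def)
  finally show ?thesis using assms by (simp add: divide_right_mono)
qed

text \<open>Pinsker in linearised form: the choice \<open>c = sqrt k / 2\<close> would turn
  \<open>k / (4 * c) + c\<close> into \<open>sqrt k\<close>. Keeping \<open>c\<close> free lets the
  same bound serve for \<open>k = 0\<close> and for several terms at once.\<close>

lemma KL_integral_bound:
  fixes f g u :: "'b \<Rightarrow> real"
  assumes int: "integrable M f" "integrable M g"
    and one: "integral\<^sup>L M f = 1" "integral\<^sup>L M g = 1"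
    and nn: "\<And>x. 0 \<le> f x" "\<And>x. 0 \<le> g x" and ac: "AE x in M. g x = 0 \<longrightarrow> f x = 0"
    and kl: "integrable M (\<lambda>x. f x * ln (f x / g x))"
    and u: "u \<in> borel_measurable M" "AE x in M. 0 \<le> u x \<and> u x \<le> 1" and c: "c > 0"
  shows "\<bar>(\<integral>x. f x * u x \<partial>M) - (\<integral>x. g x * u x \<partial>M)\<bar>
    \<le> (\<integral>x. f x * ln (f x / g x) \<partial>M) / (4 * c) + c"
proof -
  have iu: "integrable M (\<lambda>x. h x * u x)" if "integrable M h" for h
  proof (rule Bochner_Integration.integrable_bound[OF that])
    show "AE x in M. norm (h x * u x) \<le> norm (h x)"
      using u(2) by eventually_elim (simp add: abs_mult mult_left_le)
  qed (use u(1) that in auto)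
  \<comment> \<open>As \<open>f\<close> and \<open>g\<close> have equal mass, \<open>u\<close> may
    be replaced by \<open>u - 1/2\<close>, whose absolute value is at most 1/2; this gains a factor
    2.\<close>
  have "(\<integral>x. f x * u x \<partial>M) - (\<integral>x. g x * u x \<partial>M)
      = (\<integral>x. (f x * u x - g x * u x) - (f x - g x) / 2 \<partial>M)"
    using int one iu by simp
  also have "\<dots> = (\<integral>x. (f x - g x) * (u x - 1 / 2) \<partial>M)"
    by (intro Bochner_Integration.integral_cong) (auto simp: field_simps)
  also have "\<bar>\<dots>\<bar> \<le> (\<integral>x. \<bar>f x - g x\<bar> / 2 \<partial>M)"
  proof (intro order_trans[OF integral_abs_bound] integral_mono_AE)
    have "(\<lambda>x. (f x - g x) * (u x - 1/2)) = (\<lambda>x. (f x * u x - g x * u x) - (f x - g x) / 2)"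
      by (auto simp: fun_eq_iff field_simps)
    then show "integrable M (\<lambda>x. \<bar>(f x - g x) * (u x - 1/2)\<bar>)" using int iu by simp
    show "AE x in M. \<bar>(f x - g x) * (u x - 1 / 2)\<bar> \<le> \<bar>f x - g x\<bar> / 2"
      using u(2)
    proof eventually_elim
      case (elim x)
      then have "\<bar>u x - 1/2\<bar> \<le> 1/2" by arith
      then have "\<bar>f x - g x\<bar> * \<bar>u x - 1/2\<bar> \<le> \<bar>f x - g x\<bar> * (1/2)" by (intro mult_left_mono) auto
      then show ?case by (simp add: abs_mult)
    qed
  qed (use int in auto)
  also have "\<dots> \<le> (\<integral>x. ((f x * ln (f x / g x) - (f x - g x)) / (2 * c) + c * (f x + g x)) / 2 \<partial>M)"
    using int kl ac
    by (intro integral_mono_AE)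
      (auto elim!: eventually_mono intro!: abs_diff_le_xlnx divide_right_mono nn c)
  also have "\<dots> = (\<integral>x. f x * ln (f x / g x) \<partial>M) / (4 * c) + c"
    using int kl one by simp
  finally show ?thesis .
qed

lemma KL_integral_nonneg:
  fixes f g :: "'b \<Rightarrow> real"
  assumes int: "integrable M f" "integrable M g"
    and one: "integral\<^sup>L M f = 1" "integral\<^sup>L M g = 1"
    and nn: "\<And>x. 0 \<le> f x" "\<And>x. 0 \<le> g x" and ac: "AE x in M. g x = 0 \<longrightarrow> f x = 0"
    and kl: "integrable M (\<lambda>x. f x * ln (f x / g x))"
  shows "0 \<le> (\<integral>x. f x * ln (f x / g x) \<partial>M)"
proof -
  have "0 = (\<integral>x. f x - g x \<partial>M)" using int one by simp
  also have "\<dots> \<le> (\<integral>x. f x * ln (f x / g x) \<partial>M)"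
    using int kl ac
  proof (intro integral_mono_AE)
    show "AE x in M. f x - g x \<le> f x * ln (f x / g x)"
      using ac
    proof eventually_elim
      case (elim x)
      from xlnx_lower_bound[OF nn(1)[of x] nn(2)[of x] elim] zero_le_power2[of "sqrt (f x) - sqrt (g x)"]
      show ?case by linarith
    qed
  qed auto
  finally show ?thesis .
qed

text \<open>The integrand is at least \<open>f - g\<close>, hence at least \<open>- g\<close>, so
  its negative part has finite integral. The extended integral is therefore never of the form
  infinity minus infinity: it is infinite or an ordinary Bochner integral.\<close>

lemma ext_integral_KL_cases:
  fixes f g :: "'b \<Rightarrow> real"
  assumes int: "integrable M f" "integrable M g"
    and nn: "\<And>x. 0 \<le> f x" "\<And>x. 0 \<le> g x" and ac: "AE x in M. g x = 0 \<longrightarrow> f x = 0"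
  obtains "ext_integral M (\<lambda>x. f x * ln (f x / g x)) = \<infinity>"
  | "integrable M (\<lambda>x. f x * ln (f x / g x))"
    "ext_integral M (\<lambda>x. f x * ln (f x / g x)) = ereal (\<integral>x. f x * ln (f x / g x) \<partial>M)"
proof -
  let ?F = "\<lambda>x. f x * ln (f x / g x)"
  have [measurable]: "f \<in> borel_measurable M" "g \<in> borel_measurable M" using int by auto
  have "(\<integral>\<^sup>+x. ennreal (- ?F x) \<partial>M) \<le> (\<integral>\<^sup>+x. ennreal (g x) \<partial>M)"
  proof (intro nn_integral_mono_AE)
    show "AE x in M. ennreal (- ?F x) \<le> ennreal (g x)"
      using ac
    proof eventually_elim
      case (elim x)
      from xlnx_lower_bound[OF nn(1)[of x] nn(2)[of x] elim] zero_le_power2[of "sqrt (f x) - sqrt (g x)"] nn(1)[of x]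
      show ?case by (intro ennreal_leI) linarith
    qed
  qed
  also have "\<dots> < \<infinity>" using int(2) nn(2) by (simp add: nn_integral_eq_integral)
  finally have neg: "(\<integral>\<^sup>+x. ennreal (- ?F x) \<partial>M) < \<infinity>" .
  show ?thesis
  proof (cases "(\<integral>\<^sup>+x. ennreal (?F x) \<partial>M) = \<infinity>")
    case True
    have "ext_integral M ?F = \<infinity>"
      unfolding ext_integral_def True using neg
      by (cases "\<integral>\<^sup>+x. ennreal (- ?F x) \<partial>M" rule: ennreal_cases) (auto simp: enn2ereal_ennreal)
    then show ?thesis by (rule that)
  next
    case False
    have I: "integrable M ?F"
      using False neg by (auto simp: real_integrable_def)
    have "ext_integral M ?F = ereal (\<integral>x. ?F x \<partial>M)"
      unfolding ext_integral_def real_lebesgue_integral_def[OF I]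
      using False neg
      by (cases "\<integral>\<^sup>+x. ennreal (- ?F x) \<partial>M" rule: ennreal_cases;
          cases "\<integral>\<^sup>+x. ennreal (?F x) \<partial>M" rule: ennreal_cases)
        (auto simp: enn2ereal_ennreal)
    with I show ?thesis by (rule that)
  qed
qed

section \<open>Divergence of transitions and of rewards\<close>

definition rew_KL :: "real measure \<Rightarrow> ('s, 'a) mdp \<Rightarrow> ('s, 'a) mdp \<Rightarrow> 's \<Rightarrow> 'a \<Rightarrow> ereal" where
  "rew_KL lam \<phi> \<psi> x a = ext_integral lam (\<lambda>r. rew_density lam \<phi> x a r *
       ln (rew_density lam \<phi> x a r / rew_density lam \<psi> x a r))"

definition trans_KL :: "('s::finite, 'a) mdp \<Rightarrow> ('s, 'a) mdp \<Rightarrow> 's \<Rightarrow> 'a \<Rightarrow> real" where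
  "trans_KL \<phi> \<psi> x a =
     (\<Sum>y\<in>UNIV. pmf (trans \<phi> x a) y * ln (pmf (trans \<phi> x a) y / pmf (trans \<psi> x a) y))"

text \<open>The transition summand is a finite real sum, so an infinite divergence can only come
  from the rewards.\<close>

lemma KL_decomp: "KL lam \<phi> \<psi> x a = ereal (trans_KL \<phi> \<psi> x a) + rew_KL lam \<phi> \<psi> x a"
  by (simp add: KL_def rew_KL_def trans_KL_def)

text \<open>The general integral bounds, applied to the counting measure, where every function on a
  finite type is integrable.\<close>

lemma
  fixes \<phi> \<psi> :: "('s::finite, 'a) mdp"
  assumes ac: "mdp_ac \<phi> \<psi>"
  shows trans_KL_nonneg: "0 \<le> trans_KL \<phi> \<psi> x a"
    and trans_KL_bound: "(\<And>y. 0 \<le> u y \<and> u y \<le> 1) \<Longrightarrow> c > 0 \<Longrightarrow>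
      \<bar>(\<Sum>y\<in>UNIV. pmf (trans \<phi> x a) y * u y) - (\<Sum>y\<in>UNIV. pmf (trans \<psi> x a) y * u y)\<bar>
      \<le> trans_KL \<phi> \<psi> x a / (4 * c) + c"
proof -
  let ?M = "count_space (UNIV :: 's set)"
  let ?f = "pmf (trans \<phi> x a)" and ?g = "pmf (trans \<psi> x a)"
  have int: "integrable ?M h" for h :: "'s \<Rightarrow> real"
    by (intro integrable_count_space) simp
  have sum: "integral\<^sup>L ?M h = sum h UNIV" for h :: "'s \<Rightarrow> real"
    by (intro lebesgue_integral_count_space_finite) simp
  have one: "integral\<^sup>L ?M ?f = 1" "integral\<^sup>L ?M ?g = 1"
    by (simp_all add: sum sum_pmf_eq_1)
  have "absolutely_continuous (measure_pmf (trans \<psi> x a)) (measure_pmf (trans \<phi> x a))"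
    using ac by (simp add: mdp_ac_def)
  then have z: "?g y = 0 \<longrightarrow> ?f y = 0" for y
    unfolding absolutely_continuous_def null_sets_def
    by (auto simp: pmf.rep_eq measure_pmf.emeasure_eq_measure subset_iff)
  have AE: "AE y in ?M. ?g y = 0 \<longrightarrow> ?f y = 0" using z by simp
  show "0 \<le> trans_KL \<phi> \<psi> x a"
    using KL_integral_nonneg[OF int int one _ _ AE int] by (simp add: sum trans_KL_def)
  show "\<bar>(\<Sum>y\<in>UNIV. ?f y * u y) - (\<Sum>y\<in>UNIV. ?g y * u y)\<bar> \<le> trans_KL \<phi> \<psi> x a / (4 * c) + c"
    if "\<And>y. 0 \<le> u y \<and> u y \<le> 1" "c > 0"
    using KL_integral_bound[OF int int one _ _ AE int, of u c] that by (simp add: sum trans_KL_def)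
qed

text \<open>\<open>RN_deriv\<close> chooses some density whenever one exists, and membership in
  \<open>reward_laws\<close> provides one.\<close>

lemma reward_lawsD:
  assumes "Q \<in> reward_laws lam"
  shows "prob_space Q" "sets Q = sets lam" "density lam (RN_deriv lam Q) = Q"
proof -
  from assms obtain f where f: "f \<in> borel_measurable lam" "Q = density lam f" and "prob_space Q"
    by (auto simp: reward_laws_def)
  then show "prob_space Q" "sets Q = sets lam" "density lam (RN_deriv lam Q) = Q"
    using RN_derivI[OF f(1) f(2)[symmetric]] by auto
qed

lemma
  assumes Q: "Q \<in> reward_laws lam"
  shows reward_law_density: "density lam (\<lambda>r. ennreal (enn2real (RN_deriv lam Q r))) = Q"
    and integrable_reward_law_density: "integrable lam (\<lambda>r. enn2real (RN_deriv lam Q r))"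
    and integral_reward_law_density: "(\<integral>r. enn2real (RN_deriv lam Q r) \<partial>lam) = 1"
proof -
  note D = reward_lawsD[OF Q]
  have one: "(\<integral>\<^sup>+r. RN_deriv lam Q r \<partial>lam) = 1"
  proof -
    have "emeasure Q (space Q) = 1" using D(1) by (rule prob_space.emeasure_space_1)
    also have "emeasure Q (space Q) = emeasure (density lam (RN_deriv lam Q)) (space lam)"
      using D(2,3) sets_eq_imp_space_eq[OF D(2)] by simp
    also have "\<dots> = (\<integral>\<^sup>+r. RN_deriv lam Q r \<partial>lam)"
      by (subst emeasure_density) (auto intro!: nn_integral_cong)
    finally show ?thesis by simp
  qed
  \<comment> \<open>\<open>enn2real\<close> sends infinity to 0, so the real-valued density is
    faithful only because the derivative has integral 1 and is finite almost everywhere.\<close>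
  have "AE r in lam. RN_deriv lam Q r \<noteq> \<infinity>"
    using one by (intro nn_integral_noteq_infinite) auto
  then have eq: "AE r in lam. ennreal (enn2real (RN_deriv lam Q r)) = RN_deriv lam Q r"
    by eventually_elim (simp add: less_top)
  then show "density lam (\<lambda>r. ennreal (enn2real (RN_deriv lam Q r))) = Q"
    by (subst D(3)[symmetric], intro density_cong) auto
  have *: "(\<integral>\<^sup>+r. ennreal (enn2real (RN_deriv lam Q r)) \<partial>lam) = ennreal 1"
    using nn_integral_cong_AE[OF eq] one by simp
  show "integrable lam (\<lambda>r. enn2real (RN_deriv lam Q r))"
    by (rule integrableI_nn_integral_finite[OF _ _ *]) auto
  show "(\<integral>r. enn2real (RN_deriv lam Q r) \<partial>lam) = 1"
    by (intro integral_eq_nn_integral[THEN trans]) (auto simp: *)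
qed

text \<open>The mean reward is the integral of the identity, which takes values in
  \<open>{0..1}\<close> on the space of \<open>lam\<close>, so it serves as the test function
  \<open>u\<close> in \<open>KL_integral_bound\<close>.\<close>

lemma
  assumes l: "sets lam = sets unit_borel"
    and un: "\<phi> \<in> unstructured lam" "\<psi> \<in> unstructured lam" and ac: "mdp_ac \<phi> \<psi>"
  shows rew_KL_nonneg: "0 \<le> rew_KL lam \<phi> \<psi> x a"
    and rew_KL_bound: "c > 0 \<Longrightarrow> rew_KL lam \<phi> \<psi> x a = ereal k \<Longrightarrow>
      \<bar>mean_reward \<phi> x a - mean_reward \<psi> x a\<bar> \<le> k / (4 * c) + c"
proof -
  let ?f = "rew_density lam \<phi> x a" and ?g = "rew_density lam \<psi> x a"
  have laws: "rew \<phi> x a \<in> reward_laws lam" "rew \<psi> x a \<in> reward_laws lam"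
    using un by (auto simp: unstructured_def)
  note f = integrable_reward_law_density[OF laws(1), folded rew_density_def]
    integral_reward_law_density[OF laws(1), folded rew_density_def]
    reward_law_density[OF laws(1), folded rew_density_def]
  note g = integrable_reward_law_density[OF laws(2), folded rew_density_def]
    integral_reward_law_density[OF laws(2), folded rew_density_def]
    reward_law_density[OF laws(2), folded rew_density_def]
  have nn: "0 \<le> rew_density lam m x a r" for m r by (simp add: rew_density_def)
  have mf[measurable]: "?f \<in> borel_measurable lam" and mg[measurable]: "?g \<in> borel_measurable lam"
    using f g by auto
  \<comment> \<open>The zero set of \<open>?g\<close> is null for the reward law of
    \<open>\<psi>\<close>, hence for that of \<open>\<phi>\<close>, and so \<open>?f\<close>
    vanishes almost everywhere on it.\<close>
  have AE: "AE r in lam. ?g r = 0 \<longrightarrow> ?f r = 0"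
  proof -
    let ?N = "{r \<in> space lam. ?g r = 0}"
    have "emeasure (rew \<psi> x a) ?N = 0"
      by (subst g(3)[symmetric], subst emeasure_density)
        (auto simp: nn_integral_0_iff_AE intro!: AE_I2 split: split_indicator)
    then have "?N \<in> null_sets (rew \<psi> x a)"
      using reward_lawsD(2)[OF laws(2)] by (auto simp: null_sets_def)
    then have "?N \<in> null_sets (rew \<phi> x a)"
      using ac by (auto simp: mdp_ac_def absolutely_continuous_def)
    then have "?N \<in> null_sets (density lam (\<lambda>r. ennreal (?f r)))" unfolding f(3) .
    then have "AE r in lam. r \<in> ?N \<longrightarrow> ennreal (?f r) = 0"
      by (subst (asm) null_sets_density_iff) auto
    then show ?thesis
      using AE_space by eventually_elim (auto simp: nn antisym[OF _ nn])
  qed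
  note cases = ext_integral_KL_cases[OF f(1) g(1) nn nn AE, folded rew_KL_def]
  show "0 \<le> rew_KL lam \<phi> \<psi> x a"
  proof (rule cases)
    assume "integrable lam (\<lambda>r. ?f r * ln (?f r / ?g r))"
      and "rew_KL lam \<phi> \<psi> x a = ereal (\<integral>r. ?f r * ln (?f r / ?g r) \<partial>lam)"
    then show ?thesis
      using KL_integral_nonneg[OF f(1) g(1) f(2) g(2) nn nn AE] by simp
  qed simp
  assume c: "c > 0" and k: "rew_KL lam \<phi> \<psi> x a = ereal k"
  have id: "(\<lambda>r. r) \<in> borel_measurable lam"
    unfolding measurable_cong_sets[OF l refl] by (simp add: measurable_restrict_space1)
  have mr: "mean_reward \<phi> x a = (\<integral>r. ?f r * r \<partial>lam)"
    unfolding mean_reward_def by (subst f(3)[symmetric], subst integral_real_density) (auto simp: nn id)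
  have mr': "mean_reward \<psi> x a = (\<integral>r. ?g r * r \<partial>lam)"
    unfolding mean_reward_def by (subst g(3)[symmetric], subst integral_real_density) (auto simp: nn id)
  have unit: "AE r in lam. 0 \<le> r \<and> r \<le> 1"
    using sets_eq_imp_space_eq[OF l] by (intro AE_I2) (auto simp: space_restrict_space)
  show "\<bar>mean_reward \<phi> x a - mean_reward \<psi> x a\<bar> \<le> k / (4 * c) + c"
  proof (rule cases)
    assume "integrable lam (\<lambda>r. ?f r * ln (?f r / ?g r))"
      and "rew_KL lam \<phi> \<psi> x a = ereal (\<integral>r. ?f r * ln (?f r / ?g r) \<partial>lam)"
    then show ?thesis
      using KL_integral_bound[OF f(1) g(1) f(2) g(2) nn nn AE _ id unit c] k by (simp add: mr mr')
  qed (simp add: k)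
qed

section \<open>Bellman equations\<close>

lemma bellman_le_bellman_opt: "bellman \<phi> a h y \<le> bellman_opt \<phi> h y"
  unfolding bellman_opt_def by (rule Max_ge) auto

lemma bellman_opt_attained: "\<exists>a. bellman \<phi> a h y = bellman_opt \<phi> h y"
proof -
  have "bellman_opt \<phi> h y \<in> range (\<lambda>a. bellman \<phi> a h y)"
    unfolding bellman_opt_def by (rule Max_in) auto
  then show ?thesis by auto
qed

lemma bellman_shift: "bellman \<phi> a (\<lambda>y. h y - c) x = bellman \<phi> a h x - c"
  by (simp add: bellman_def right_diff_distrib sum_subtractf sum_distrib_right[symmetric])

lemma gap_nonneg: "0 \<le> gap \<phi> x a"
  unfolding gap_def using bellman_le_bellman_opt[of \<phi> a "opt_bias \<phi>" x] by simp

lemma gap_eq_0_iff: "gap \<phi> x a = 0 \<longleftrightarrow> a \<in> opt_actions \<phi> x"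
  by (auto simp: gap_def opt_actions_def)

lemma opt_bias_diff_le_span: "opt_bias \<phi> y - opt_bias \<phi> z \<le> bias_span \<phi>"
  unfolding bias_span_def by (rule Max_ge) auto

lemma bias_span_nonneg: "0 \<le> bias_span \<phi>"
  using opt_bias_diff_le_span[of \<phi> undefined undefined] by simp

context unstructured_mdp
begin

lemma ergodic_poisson:
  assumes "ergodic \<phi>"
  obtains g h where "\<And>y. bellman \<phi> (f y) h y = g + h y"
proof (rule poisson_equation_solvable[OF irreducible_policy_kernel[OF assms, of f]])
  fix g h
  assume "\<And>y. mean_reward \<phi> y (f y) + chain_op (policy_kernel \<phi> f) h y = g + h y"
  then show ?thesis by (intro that[of h g]) (simp add: bellman_policy)
qed

lemma gain_constant:
  assumes "ergodic \<phi>"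
  shows "gain \<phi> f x = gain \<phi> f y"
proof -
  obtain g h where P: "\<And>y. bellman \<phi> (f y) h y = g + h y" using ergodic_poisson[OF assms, of f] by metis
  show ?thesis using gain_eqI[OF P, of x] gain_eqI[OF P, of y] by simp
qed

text \<open>By \<open>poisson_cesaro\<close> the bias is a Poisson solution shifted by a constant,
  and the equation is invariant under such shifts.\<close>

lemma bias_poisson:
  assumes "ergodic \<phi>"
  shows "bellman \<phi> (f y) (bias \<phi> f) y = gain \<phi> f y + bias \<phi> f y"
proof -
  obtain g h where P: "\<And>y. bellman \<phi> (f y) h y = g + h y" using ergodic_poisson[OF assms, of f] by metis
  have g: "gain \<phi> f z = g" for z by (rule gain_eqI[OF P])
  obtain c where c: "\<And>x. (\<lambda>N. (\<Sum>T=1..N. (\<Sum>t<T. (chain_op (policy_kernel \<phi> f) ^^ t)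
      (\<lambda>y. mean_reward \<phi> y (f y)) x) - real T * g) / real N) \<longlonglongrightarrow> h x - c"
    using poisson_cesaro[OF irreducible_policy_kernel[OF assms] P[unfolded bellman_policy]] by blast
  have "bias \<phi> f x = h x - c" for x
  proof -
    interpret prob_space "traj \<phi> (stationary f) x" by (rule prob_space_traj[OF stationary_in_policies])
    have "(\<integral>\<omega>. (\<Sum>t<T. reward_at \<omega> t - gain \<phi> f (state_at \<omega> t)) \<partial>traj \<phi> (stationary f) x)
      = (\<Sum>t<T. (chain_op (policy_kernel \<phi> f) ^^ t) (\<lambda>y. mean_reward \<phi> y (f y)) x) - real T * g" for T
      using integrable_traj_reward[OF stationary_in_policies, of f x] prob_space
      by (simp add: g sum_subtractf integral_traj_stationary_reward)
    then show ?thesis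
      unfolding bias_def cesaro_lim_def by (simp only: limI[OF c])
  qed
  then have "bias \<phi> f = (\<lambda>x. h x - c)" by auto
  then show ?thesis by (simp add: bellman_shift P g)
qed

text \<open>Otherwise switching to the maximising actions would strictly increase the gain.\<close>
lemma gain_maximal_bellman_opt:
  assumes "ergodic \<phi>" and P: "\<And>y. bellman \<phi> (f y) h y = g + h y"
    and max: "\<And>f' y. gain \<phi> f' y \<le> g"
  shows "bellman_opt \<phi> h y = g + h y"
proof (rule ccontr)
  assume neq: "bellman_opt \<phi> h y \<noteq> g + h y"
  have ge: "g + h z \<le> bellman_opt \<phi> h z" for z
    using bellman_le_bellman_opt[of \<phi> "f z" h z] by (simp add: P)
  obtain f' where f': "\<And>z. bellman \<phi> (f' z) h z = bellman_opt \<phi> h z"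
    using bellman_opt_attained[of \<phi> h] by metis
  obtain g' h' where P': "\<And>y. bellman \<phi> (f' y) h' y = g' + h' y"
    using ergodic_poisson[OF assms(1), of f'] by metis
  have "g + h y < bellman_opt \<phi> h y" using ge[of y] neq by simp
  then have "g < g'"
    using ge P'
    by (intro poisson_gain_less[OF irreducible_policy_kernel[OF assms(1), of f'],
          of "\<lambda>y. mean_reward \<phi> y (f' y)" h' g' g h y])
      (simp_all flip: bellman_policy add: f')
  with max[of f' y] gain_eqI[OF P'] show False by simp
qed

lemma optimal_policy_bellman:
  assumes "ergodic \<phi>"
  obtains f g where "f \<in> opt_policies \<phi>" "\<And>y. bellman \<phi> (f y) (opt_bias \<phi>) y = g + opt_bias \<phi> y"
    "\<And>y. bellman_opt \<phi> (opt_bias \<phi>) y = g + opt_bias \<phi> y"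
proof -
  \<comment> \<open>The gain does not depend on the state, so any base state will do.\<close>
  define G where "G f = gain \<phi> f undefined" for f
  have G: "gain \<phi> f x = G f" for f x unfolding G_def by (rule gain_constant[OF assms])
  \<comment> \<open>A best policy among the finitely many deterministic ones; its Bellman optimality
    equation shows that no policy at all does better, so optimal policies exist.\<close>
  have "Max (range G) \<in> range G" by (rule Max_in) auto
  then obtain f1 where f1: "G f1 = Max (range G)" by (metis imageE)
  have max1: "gain \<phi> f y \<le> G f1" for f y unfolding f1 G by (rule Max_ge) auto
  have P1: "bellman \<phi> (f1 y) (bias \<phi> f1) y = G f1 + bias \<phi> f1 y" for y
    using bias_poisson[OF assms, of f1 y] by (simp add: G)
  have "bellman \<phi> a (bias \<phi> f1) y \<le> G f1 + bias \<phi> f1 y" for y a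
    using bellman_le_bellman_opt[of \<phi> a "bias \<phi> f1" y] gain_maximal_bellman_opt[OF assms P1 max1, of y] by simp
  then have "opt_gain \<phi> x \<le> ereal (G f1)" for x by (rule opt_gain_le)
  then have opt1: "opt_gain \<phi> x = ereal (G f1)" for x
    using gain_le_opt_gain[OF P1] by (rule antisym)
  \<comment> \<open>\<open>opt_bias\<close> is the bias of the chosen policy, which may differ from
    \<open>f1\<close>. It has the same maximal gain, so the argument applies to its own
    bias.\<close>
  define f where "f = (SOME f. f \<in> opt_policies \<phi>)"
  have "f1 \<in> opt_policies \<phi>" by (simp add: opt_policies_def opt1 G)
  then have f: "f \<in> opt_policies \<phi>" unfolding f_def by (rule someI[of "\<lambda>f. f \<in> opt_policies \<phi>"])
  have "gain \<phi> f y = G f1" for y using f by (simp add: opt_policies_def opt1)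
  then have P: "bellman \<phi> (f y) (opt_bias \<phi>) y = G f1 + opt_bias \<phi> y" for y
    using bias_poisson[OF assms, of f y] by (simp add: opt_bias_def f_def)
  show ?thesis
    by (rule that[OF f P gain_maximal_bellman_opt[OF assms P max1]])
qed

text \<open>Verification: \<open>P\<close> fixes the gain of \<open>f\<close> and \<open>le\<close>
  bounds that of all policies. As only Bellman relations enter, it applies to a confusing
  \<open>\<psi>\<close> without first proving \<open>\<psi>\<close> ergodic.\<close>

lemma opt_policyI:
  assumes P: "\<And>y. bellman \<phi> (f y) h y = g + h y" and le: "\<And>y a. bellman \<phi> a h y \<le> g + h y"
  shows "f \<in> opt_policies \<phi>"
  using gain_eqI[OF P] gain_le_opt_gain[OF P] opt_gain_le[OF le]
  by (simp add: opt_policies_def order_antisym)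

end

section \<open>Comparison of a model with a confusing one\<close>

lemma KL_nonneg:
  fixes \<phi> \<psi> :: "('s::finite, 'a) mdp"
  assumes "sets lam = sets unit_borel" "\<phi> \<in> unstructured lam" "\<psi> \<in> unstructured lam" "mdp_ac \<phi> \<psi>"
  shows "0 \<le> KL lam \<phi> \<psi> x a"
  unfolding KL_decomp using trans_KL_nonneg[OF assms(4)] rew_KL_nonneg[OF assms] by (intro add_nonneg_nonneg) auto

text \<open>Rewards contribute one test function with values in the unit interval; \<open>h\<close>,
  shifted and rescaled to that interval, contributes \<open>H\<close> times another. Each part of
  the divergence is at most \<open>k\<close>, as the other is nonnegative.\<close>

lemma bellman_diff_le_KL:
  fixes \<phi> \<psi> :: "('s::finite, 'a) mdp"
  assumes l: "sets lam = sets unit_borel" and un: "\<phi> \<in> unstructured lam" "\<psi> \<in> unstructured lam"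
    and ac: "mdp_ac \<phi> \<psi>" and k: "KL lam \<phi> \<psi> x a = ereal k" and c: "c > 0"
    and H: "\<And>y z. h y - h z \<le> H"
  shows "\<bar>bellman \<phi> a h x - bellman \<psi> a h x\<bar> \<le> (H + 1) * (k / (4 * c) + c)"
proof -
  obtain k' where k': "rew_KL lam \<phi> \<psi> x a = ereal k'" and k_eq: "k = trans_KL \<phi> \<psi> x a + k'"
    using k unfolding KL_decomp by (cases "rew_KL lam \<phi> \<psi> x a") auto
  have nn: "0 \<le> trans_KL \<phi> \<psi> x a" "0 \<le> k'"
    using trans_KL_nonneg[OF ac, of x a] rew_KL_nonneg[OF l un ac, of x a] k' by auto
  have H0: "0 \<le> H" using H[of undefined undefined] by simp
  define m where "m = Min (range h)"
  have "m \<in> range h" unfolding m_def by (rule Min_in) auto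
  then obtain z where z: "m = h z" by auto
  have m: "m \<le> h y" "h y - m \<le> H" for y unfolding z using H[of y z] by (auto simp: z[symmetric] m_def)
  \<comment> \<open>If \<open>H = 0\<close>, then \<open>u = 0\<close> since \<open>x / 0 = 0\<close>, and \<open>h\<close> is constantly \<open>m\<close>.\<close>
  define u where "u y = (h y - m) / H" for y
  have u: "0 \<le> u y \<and> u y \<le> 1" for y using m[of y] H0 by (auto simp: u_def divide_le_eq)
  have h: "h y = m + H * u y" for y using m[of y] H0 by (auto simp: u_def)
  have sum_h: "(\<Sum>y\<in>UNIV. pmf p y * h y) = m + H * (\<Sum>y\<in>UNIV. pmf p y * u y)" for p :: "'s pmf"
    by (simp add: h distrib_left sum.distrib sum_distrib_right[symmetric])
      (simp add: sum_distrib_left mult_ac)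
  define dt where "dt = (\<Sum>y\<in>UNIV. pmf (trans \<phi> x a) y * u y) - (\<Sum>y\<in>UNIV. pmf (trans \<psi> x a) y * u y)"
  define dr where "dr = mean_reward \<phi> x a - mean_reward \<psi> x a"
  have "\<bar>dt\<bar> \<le> trans_KL \<phi> \<psi> x a / (4 * c) + c"
    unfolding dt_def by (rule trans_KL_bound[OF ac u c])
  also have "\<dots> \<le> k / (4 * c) + c" using nn c by (simp add: k_eq divide_right_mono)
  finally have t: "\<bar>dt\<bar> \<le> k / (4 * c) + c" .
  have "\<bar>dr\<bar> \<le> k' / (4 * c) + c" unfolding dr_def by (rule rew_KL_bound[OF l un ac c k'])
  also have "\<dots> \<le> k / (4 * c) + c" using nn c by (simp add: k_eq divide_right_mono)
  finally have r: "\<bar>dr\<bar> \<le> k / (4 * c) + c" .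
  have "\<bar>bellman \<phi> a h x - bellman \<psi> a h x\<bar> = \<bar>dr + H * dt\<bar>"
    unfolding bellman_def sum_h dt_def dr_def by (simp add: algebra_simps)
  also have "\<dots> \<le> \<bar>dr\<bar> + H * \<bar>dt\<bar>" using H0 abs_triangle_ineq[of dr "H * dt"] by (simp add: abs_mult)
  also have "\<dots> \<le> (k / (4 * c) + c) + H * (k / (4 * c) + c)" using r t H0 by (intro add_mono mult_left_mono)
  also have "\<dots> = (H + 1) * (k / (4 * c) + c)" by (simp only: distrib_right mult_1_left add.commute)
  finally show ?thesis .
qed

text \<open>With \<open>k = 0\<close> the bound is \<open>(H + 1) * c\<close> for every
  \<open>c > 0\<close>; the chosen \<open>c\<close> makes it half of the difference itself.\<close>

lemma bellman_eq_if_KL_0: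
  fixes \<phi> \<psi> :: "('s::finite, 'a) mdp"
  assumes l: "sets lam = sets unit_borel" and un: "\<phi> \<in> unstructured lam" "\<psi> \<in> unstructured lam"
    and ac: "mdp_ac \<phi> \<psi>" and k: "KL lam \<phi> \<psi> x a = 0"
    and H: "\<And>y z. h y - h z \<le> H"
  shows "bellman \<phi> a h x = bellman \<psi> a h x"
proof (rule ccontr)
  assume "bellman \<phi> a h x \<noteq> bellman \<psi> a h x"
  then have D: "\<bar>bellman \<phi> a h x - bellman \<psi> a h x\<bar> > 0" (is "?D > 0") by simp
  have "H \<ge> 0" using H[of undefined undefined] by simp
  then have "?D \<le> (H + 1) * (?D / (2 * (H + 1)))"
    using bellman_diff_le_KL[OF l un ac _ _ H, of x a 0 "?D / (2 * (H + 1))"] D k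
    by (simp add: zero_ereal_def)
  also have "\<dots> = ?D / 2" using \<open>H \<ge> 0\<close> by (simp add: field_simps)
  finally show False using D by simp
qed

lemma confusing_has_large_KL:
  fixes \<phi> :: "('s::finite, 'a::finite) mdp"
  assumes l: "sets lam = sets unit_borel" and \<phi>: "\<phi> \<in> unstructured lam" and erg: "ergodic \<phi>"
    and conf: "\<psi> \<in> confusing lam (unstructured lam) \<phi>"
  obtains x a where "a \<notin> opt_actions \<phi> x" "ereal ((gap \<phi> x a / (bias_span \<phi> + 1))\<^sup>2) \<le> KL lam \<phi> \<psi> x a"
proof -
  from conf have \<psi>: "\<psi> \<in> unstructured lam" and ac: "mdp_ac \<phi> \<psi>"
    and KL0: "\<And>x a. a \<in> opt_actions \<phi> x \<Longrightarrow> KL lam \<phi> \<psi> x a = 0"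
    and disj: "opt_policies \<phi> \<inter> opt_policies \<psi> = {}"
    by (auto simp: confusing_def)
  interpret \<phi>: unstructured_mdp lam \<phi> by unfold_locales (fact l \<phi>)+
  interpret \<psi>: unstructured_mdp lam \<psi> by unfold_locales (fact l \<psi>)+
  let ?h = "opt_bias \<phi>" and ?H = "bias_span \<phi>"
  note span = opt_bias_diff_le_span[of \<phi>]
  obtain f g where f: "f \<in> opt_policies \<phi>" and P: "\<And>y. bellman \<phi> (f y) ?h y = g + ?h y"
    and opt: "\<And>y. bellman_opt \<phi> ?h y = g + ?h y"
    using \<phi>.optimal_policy_bellman[OF erg] by metis
  have eq: "bellman \<psi> a ?h y = bellman \<phi> a ?h y" if "a \<in> opt_actions \<phi> y" for a y
    using bellman_eq_if_KL_0[OF l \<phi> \<psi> ac KL0[OF that] span] by simp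
  have "f y \<in> opt_actions \<phi> y" for y by (simp add: opt_actions_def P opt)
  then have P\<psi>: "bellman \<psi> (f y) ?h y = g + ?h y" for y by (simp add: eq P)
  have "f \<notin> opt_policies \<psi>" using f disj by auto
  then have "\<not> (\<forall>y a. bellman \<psi> a ?h y \<le> g + ?h y)" using \<psi>.opt_policyI[OF P\<psi>] by blast
  then obtain x a where xa: "bellman \<psi> a ?h x > g + ?h x" by (auto simp: not_le)
  have not_opt: "a \<notin> opt_actions \<phi> x"
    using eq[of a x] xa bellman_le_bellman_opt[of \<phi> a ?h x] opt[of x] by auto
  define d where "d = gap \<phi> x a"
  have d: "d > 0" using not_opt gap_nonneg[of \<phi> x a] gap_eq_0_iff[of \<phi> x a] by (auto simp: d_def)
  have dd: "d < bellman \<psi> a ?h x - bellman \<phi> a ?h x" using xa by (simp add: d_def gap_def opt)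
  have H: "?H + 1 > 0" using bias_span_nonneg[of \<phi>] by simp
  have "ereal ((d / (?H + 1))\<^sup>2) \<le> KL lam \<phi> \<psi> x a"
  proof (cases "KL lam \<phi> \<psi> x a")
    case (real k)
    \<comment> \<open>This \<open>c\<close> makes the second summand contribute exactly
      \<open>d / 2\<close>, which is absorbed on the left; what remains is
      \<open>d\<^sup>2 \<le> (H + 1)\<^sup>2 * k\<close>.\<close>
    have "d \<le> (?H + 1) * (k / (4 * (d / (2 * (?H + 1)))) + d / (2 * (?H + 1)))"
      using bellman_diff_le_KL[where h="?h" and H="?H" and c="d / (2 * (?H + 1))", OF l \<phi> \<psi> ac real _ span] dd d H
      by simp
    also have "s * (k / (4 * (d / (2 * s))) + d / (2 * s)) = (s\<^sup>2 * k / d + d) / 2" if "s > 0" for s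
      using d that by (simp add: field_simps power2_eq_square)
    note this[OF H]
    finally have "d * d \<le> (?H + 1)\<^sup>2 * k" using d by (simp add: field_simps)
    then have "(d / (?H + 1))\<^sup>2 \<le> k" using H by (simp add: power_divide divide_le_eq power2_eq_square mult.commute)
    then show ?thesis by (simp add: real)
  \<comment> \<open>The value infinity is trivial, and minus infinity is excluded by
    nonnegativity.\<close>
  qed (use KL_nonneg[OF l \<phi> \<psi> ac, of x a] in auto)
  then show ?thesis using that[OF not_opt] by (simp add: d_def)
qed

lemma feasible_un_subset:
  fixes \<phi> :: "('s::finite, 'a::finite) mdp"
  assumes l: "sets lam = sets unit_borel" and \<phi>: "\<phi> \<in> unstructured lam" and erg: "ergodic \<phi>"
  shows "feasible_un \<phi> \<subseteq> feasible lam (unstructured lam) \<phi>"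
proof
  fix \<eta> assume \<eta>: "\<eta> \<in> feasible_un \<phi>"
  then have pos: "0 \<le> \<eta> xa" for xa by (cases xa) (simp add: feasible_un_def)
  have "1 \<le> (\<Sum>(x, a)\<in>UNIV. \<eta> (x, a) * KL lam \<phi> \<psi> x a)"
    if conf: "\<psi> \<in> confusing lam (unstructured lam) \<phi>" for \<psi>
  proof -
    from conf have \<psi>: "\<psi> \<in> unstructured lam" and ac: "mdp_ac \<phi> \<psi>" by (auto simp: confusing_def)
    obtain x a where xa: "a \<notin> opt_actions \<phi> x"
      "ereal ((gap \<phi> x a / (bias_span \<phi> + 1))\<^sup>2) \<le> KL lam \<phi> \<psi> x a"
      using confusing_has_large_KL[OF assms conf] by metis
    let ?t = "\<lambda>z. case z of (x, a) \<Rightarrow> \<eta> (x, a) * KL lam \<phi> \<psi> x a"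
    \<comment> \<open>The single pair \<open>(x, a)\<close> already contributes 2; all other
      summands are nonnegative.\<close>
    have "(1 :: ereal) \<le> 2" by simp
    also have "2 \<le> \<eta> (x, a) * ereal ((gap \<phi> x a / (bias_span \<phi> + 1))\<^sup>2)"
      using \<eta> xa(1) by (simp add: feasible_un_def)
    also have "\<dots> \<le> ?t (x, a)"
      using xa(2) pos by (simp add: ereal_mult_left_mono)
    also have "\<dots> = sum ?t {(x, a)}" by simp
    also have "\<dots> \<le> sum ?t UNIV"
      using pos KL_nonneg[OF l \<phi> \<psi> ac] by (intro sum_mono2) auto
    finally show ?thesis .
  qed
  with pos show "\<eta> \<in> feasible lam (unstructured lam) \<phi>" by (simp add: feasible_def)
qed

theorem mainTheorem3:
  fixes lam :: "real measure" and \<phi> :: "('s::finite, 'a::finite) mdp"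
  assumes "sets lam = sets unit_borel"
    and "\<phi> \<in> unstructured lam"
    and "ergodic \<phi>"
  shows "feasible_un \<phi> \<subseteq> feasible lam (unstructured lam) \<phi> \<and>
    (positive_gaps \<phi> \<noteq> {} \<longrightarrow>
      regret_const lam (unstructured lam) \<phi>
        \<le> ereal (2 * (bias_span \<phi> + 1)\<^sup>2 / min_gap \<phi> * real CARD('s) * real CARD('a)))"
proof (intro conjI impI)
  show sub: "feasible_un \<phi> \<subseteq> feasible lam (unstructured lam) \<phi>"
    by (rule feasible_un_subset[OF assms])
  assume ne: "positive_gaps \<phi> \<noteq> {}"
  let ?H = "bias_span \<phi>"
  have H: "?H + 1 > 0" using bias_span_nonneg[of \<phi>] by simp
  have "positive_gaps \<phi> \<subseteq> range (\<lambda>(x, a). gap \<phi> x a)" by (auto simp: positive_gaps_def)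
  then have fin: "finite (positive_gaps \<phi>)" by (rule finite_subset) simp
  have min_pos: "min_gap \<phi> > 0"
    using Min_in[OF fin ne] by (auto simp: min_gap_def positive_gaps_def)
  have gap_pos: "gap \<phi> x a > 0" if "a \<notin> opt_actions \<phi> x" for x a
    using that gap_nonneg[of \<phi> x a] gap_eq_0_iff[of \<phi> x a] by auto
  have min_le: "min_gap \<phi> \<le> gap \<phi> x a" if "a \<notin> opt_actions \<phi> x" for x a
    unfolding min_gap_def using gap_pos[OF that] by (intro Min_le fin) (auto simp: positive_gaps_def)
  \<comment> \<open>The witness meets the constraint of \<open>feasible_un\<close> with equality at
    suboptimal pairs and is 0 elsewhere; a suboptimal pair then costs
    \<open>2 * (H + 1)\<^sup>2 / gap\<close>, largest at the minimal gap.\<close>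
  define \<eta> where "\<eta> = (\<lambda>(x, a). if a \<in> opt_actions \<phi> x then 0 else 2 * ((?H + 1) / gap \<phi> x a)\<^sup>2)"
  have "(\<lambda>z. ereal (\<eta> z)) \<in> feasible_un \<phi>"
    unfolding feasible_un_def
  proof (intro CollectI conjI allI impI)
    show "0 \<le> ereal (\<eta> xa)" for xa by (auto simp: \<eta>_def split: prod.split)
    fix x a assume a: "a \<notin> opt_actions \<phi> x"
    have "\<eta> (x, a) * (gap \<phi> x a / (?H + 1))\<^sup>2 = 2"
      using gap_pos[OF a] H a by (simp add: \<eta>_def power_divide)
    then show "2 \<le> ereal (\<eta> (x, a)) * ereal ((gap \<phi> x a / (?H + 1))\<^sup>2)" by simp
  qed
  then have "(\<lambda>z. ereal (\<eta> z)) \<in> feasible lam (unstructured lam) \<phi>" using sub by blast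
  then have "regret_const lam (unstructured lam) \<phi> \<le> (\<Sum>(x, a)\<in>UNIV. ereal (\<eta> (x, a)) * ereal (gap \<phi> x a))"
    unfolding regret_const_def by (rule INF_lower)
  also have "\<dots> = ereal (\<Sum>(x, a)\<in>UNIV. \<eta> (x, a) * gap \<phi> x a)"
    by (simp add: case_prod_beta)
  also have "(\<Sum>(x, a)\<in>UNIV. \<eta> (x, a) * gap \<phi> x a) \<le> (\<Sum>z\<in>(UNIV :: ('s \<times> 'a) set). 2 * (?H + 1)\<^sup>2 / min_gap \<phi>)"
  proof (rule sum_mono, clarify)
    fix x a
    show "\<eta> (x, a) * gap \<phi> x a \<le> 2 * (?H + 1)\<^sup>2 / min_gap \<phi>"
    proof (cases "a \<in> opt_actions \<phi> x")
      case True
      then show ?thesis using min_pos by (simp add: \<eta>_def)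
    next
      case False
      have "\<eta> (x, a) * gap \<phi> x a = 2 * (?H + 1)\<^sup>2 / gap \<phi> x a"
        using False gap_pos[OF False] by (simp add: \<eta>_def power_divide power2_eq_square)
      also have "\<dots> \<le> 2 * (?H + 1)\<^sup>2 / min_gap \<phi>"
        using min_le[OF False] min_pos by (intro divide_left_mono) auto
      finally show ?thesis .
    qed
  qed
  also have "\<dots> = 2 * (?H + 1)\<^sup>2 / min_gap \<phi> * real CARD('s) * real CARD('a)"
    by (simp add: mult_ac)
  finally show "regret_const lam (unstructured lam) \<phi>
      \<le> ereal (2 * (?H + 1)\<^sup>2 / min_gap \<phi> * real CARD('s) * real CARD('a))"
    by simp
qed

end
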